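(* Let $p\in\mathbb{N}$ and let $J$ be the periodic Jacobi operator on $\ell^2(\mathbb{Z})$ with real $p$-periodic coefficient sequences $\{a_i\}_{i\in\mathbb{Z}}$, $\{b_i\}_{i\in\mathbb{Z}}$, $\{c_i\}_{i\in\mathbb{Z}}$. Suppose $b_0=b_1=\cdots=b_{p-1}=b$ and $c_0=c_1=\cdots=c_{p-1}=c$. If $\Lambda_\epsilon(J)$ is path-connected for some $\epsilon\ge |b-c|$, then $$\omega_a\le 2(\epsilon+|b-c|)(p-1).$$
   Context: For real sequences $\{a_i\},\{b_i\},\{c_i\}$ indexed by $\mathbb{Z}$ with $a_{i+p}=a_i$, $b_{i+p}=b_i$, $c_{i+p}=c_i$ for all $i$, the periodic Jacobi operator $J$ is the bounded (in general non-normal) linear operator on the complex Hilbert space $\ell^2(\mathbb{Z})$ given by the tridiagonal matrix with $$(Ju)_n=c_{n-1}u_{n-1}+a_nu_n+b_nu_{n+1},\qquad n\in\mathbb{Z}.$$ For a bounded operator $A$ on a complex Hilbert space with spectrum $\sigma(A)$ and $\epsilon>0$, the $\epsilon$-pseudospectrum is $$\Lambda_\epsilon(A)=\sigma(A)\cup\{z\in\mathbb{C}:\ z\notin\sigma(A),\ \|(zI-A)^{-1}\|\ge \epsilon^{-1}\},$$ and $\Lambda_0(A)=\sigma(A)$. Notation: $\omega_a=\max\{|a_i-a_j|: i,j=0,1,2,\ldots\}$. *)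

theory Defs
  imports "HOL-Analysis.Analysis"
begin

section \<open>Complex Hilbert spaces\<close>

class scaleC =
  fixes scaleC :: "complex \<Rightarrow> 'a \<Rightarrow> 'a"  (infixr \<open>*\<^sub>C\<close> 75)

text \<open>
  The norm, metric and topology come from the underlying real Hilbert space: together with
  the equation \<open>norm x = sqrt (x \<bullet> x)\<close> of \<^class>\<open>real_inner\<close>, the last axiom gives
  \<open>norm x = sqrt (Re (cinner x x))\<close>. The inner product is linear in its first argument.
\<close>

class complex_hilbert = real_inner + banach + scaleC +
  fixes cinner :: "'a \<Rightarrow> 'a \<Rightarrow> complex"
  assumes scaleC_add_right: "z *\<^sub>C (x + y) = z *\<^sub>C x + z *\<^sub>C y"
    and scaleC_add_left: "(z + w) *\<^sub>C x = z *\<^sub>C x + w *\<^sub>C x"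
    and scaleC_scaleC: "z *\<^sub>C (w *\<^sub>C x) = (z * w) *\<^sub>C x"
    and scaleC_of_real: "complex_of_real r *\<^sub>C x = r *\<^sub>R x"
    and cinner_commute: "cinner x y = cnj (cinner y x)"
    and cinner_add_left: "cinner (x + y) v = cinner x v + cinner y v"
    and cinner_scaleC_left: "cinner (z *\<^sub>C x) y = z * cinner x y"
    and inner_eq_Re_cinner: "x \<bullet> y = Re (cinner x y)"

definition bounded_clinear :: "('h::complex_hilbert \<Rightarrow> 'k::complex_hilbert) \<Rightarrow> bool"
  where "bounded_clinear A \<longleftrightarrow> bounded_linear A \<and> (\<forall>z x. A (z *\<^sub>C x) = z *\<^sub>C A x)"

section \<open>Spectrum and pseudospectrum\<close>

definition spectrum :: "('h::complex_hilbert \<Rightarrow> 'h) \<Rightarrow> complex set"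
  where "spectrum A =
    {z. \<not> (\<exists>R. bounded_clinear R \<and>
              (\<forall>x. R (z *\<^sub>C x - A x) = x) \<and> (\<forall>x. z *\<^sub>C R x - A (R x) = x))}"

definition resolvent :: "('h::complex_hilbert \<Rightarrow> 'h) \<Rightarrow> complex \<Rightarrow> 'h \<Rightarrow> 'h"
  where "resolvent A z = inv (\<lambda>x. z *\<^sub>C x - A x)"

text \<open>
  The conjunct \<open>\<epsilon> > 0\<close> makes the \<open>0\<close>-pseudospectrum equal to the spectrum; without it
  \<open>1 / 0 = 0\<close> would make it all of the plane.
\<close>

definition pseudospectrum :: "real \<Rightarrow> ('h::complex_hilbert \<Rightarrow> 'h) \<Rightarrow> complex set"
  where "pseudospectrum \<epsilon> A =
    spectrum A \<union> {z. z \<notin> spectrum A \<and> \<epsilon> > 0 \<and> onorm (resolvent A z) \<ge> 1 / \<epsilon>}"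

lemma pseudospectrum_0: "pseudospectrum 0 A = spectrum A"
  by (simp add: pseudospectrum_def)

lemma resolvent_unique:
  assumes "\<And>x. R (z *\<^sub>C x - A x) = x" and "\<And>x. z *\<^sub>C R x - A (R x) = x"
  shows "resolvent A z = R"
  unfolding resolvent_def by (rule inv_equality) (use assms in auto)

section \<open>The space of square-summable two-sided complex sequences\<close>

typedef ell2 = "{u :: int \<Rightarrow> complex. (\<lambda>n. (norm (u n))\<^sup>2) summable_on UNIV}"
  morphisms ell2_nth Abs_ell2
  by (rule exI[of _ "\<lambda>_. 0"]) simp

setup_lifting type_definition_ell2

lemma ell2_summable: "(\<lambda>n. (norm (ell2_nth u n))\<^sup>2) summable_on UNIV"
  using ell2_nth[of u] by simp

lemma ell2_eqI: "(\<And>n. ell2_nth u n = ell2_nth v n) \<Longrightarrow> u = v"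
  by (metis ell2_nth_inject ext)

lemma norm_add_sq_le: "(norm (x + y :: complex))\<^sup>2 \<le> 2 * (norm x)\<^sup>2 + 2 * (norm y)\<^sup>2"
proof -
  have "(norm (x + y))\<^sup>2 \<le> (norm x + norm y)\<^sup>2"
    by (simp add: norm_triangle_ineq power_mono)
  also have "\<dots> \<le> 2 * (norm x)\<^sup>2 + 2 * (norm y)\<^sup>2"
    using zero_le_power2[of "norm x - norm y"] by (simp add: power2_eq_square algebra_simps)
  finally show ?thesis .
qed

lemma sq_summable_add:
  fixes u v :: "int \<Rightarrow> complex"
  assumes "(\<lambda>n. (norm (u n))\<^sup>2) summable_on UNIV" and "(\<lambda>n. (norm (v n))\<^sup>2) summable_on UNIV"
  shows "(\<lambda>n. (norm (u n + v n))\<^sup>2) summable_on UNIV"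
  by (rule summable_on_comparison_test
        [of "\<lambda>n. 2 * (norm (u n))\<^sup>2 + 2 * (norm (v n))\<^sup>2"])
     (use assms norm_add_sq_le in \<open>auto intro!: summable_on_add summable_on_cmult_right\<close>)

lemma sq_summable_mult:
  fixes u :: "int \<Rightarrow> complex"
  assumes "(\<lambda>n. (norm (u n))\<^sup>2) summable_on UNIV" and "\<And>n. norm (f n) \<le> C"
  shows "(\<lambda>n. (norm (f n * u n))\<^sup>2) summable_on UNIV"
  by (rule summable_on_comparison_test[of "\<lambda>n. C\<^sup>2 * (norm (u n))\<^sup>2"])
     (use assms in \<open>auto intro!: summable_on_cmult_right mult_right_mono power_mono
        simp: norm_mult power_mult_distrib\<close>)

lemma sq_summable_shift:
  fixes u :: "int \<Rightarrow> complex"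
  assumes "(\<lambda>n. (norm (u n))\<^sup>2) summable_on UNIV"
  shows "(\<lambda>n. (norm (u (n + k)))\<^sup>2) summable_on UNIV"
  using summable_on_reindex_bij_betw[of "\<lambda>n. n + k" UNIV UNIV "\<lambda>n. (norm (u n))\<^sup>2"] assms
  by (simp add: bij_betw_def)

lemma sq_infsum_shift:
  fixes u :: "int \<Rightarrow> complex"
  shows "infsum (\<lambda>n. (norm (u (n + k)))\<^sup>2) UNIV = infsum (\<lambda>n. (norm (u n))\<^sup>2) UNIV"
  using infsum_reindex_bij_betw[of "\<lambda>n. n + k" UNIV UNIV "\<lambda>n. (norm (u n))\<^sup>2"]
  by (simp add: bij_betw_def)

lemma ell2_product_summable: "(\<lambda>n. ell2_nth u n * cnj (ell2_nth v n)) summable_on UNIV"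
proof (rule abs_summable_summable, rule Infinite_Sum.abs_summable_on_comparison_test')
  show "(\<lambda>n. (norm (ell2_nth u n))\<^sup>2 + (norm (ell2_nth v n))\<^sup>2) summable_on UNIV"
    by (intro summable_on_add ell2_summable)
  fix n
  define s t where "s = norm (ell2_nth u n)" and "t = norm (ell2_nth v n)"
  have "0 \<le> (s - t)\<^sup>2" "s \<ge> 0" "t \<ge> 0" by (simp_all add: s_def t_def)
  then have "2 * (s * t) \<le> s\<^sup>2 + t\<^sup>2" "0 \<le> s * t"
    by (simp_all add: power2_eq_square algebra_simps)
  then have "s * t \<le> s\<^sup>2 + t\<^sup>2" by linarith
  then show "norm (ell2_nth u n * cnj (ell2_nth v n))
      \<le> (norm (ell2_nth u n))\<^sup>2 + (norm (ell2_nth v n))\<^sup>2"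
    by (simp add: norm_mult s_def t_def)
qed

instantiation ell2 :: real_vector
begin

lift_definition zero_ell2 :: ell2 is "\<lambda>_. 0" by simp

lift_definition plus_ell2 :: "ell2 \<Rightarrow> ell2 \<Rightarrow> ell2" is "\<lambda>u v n. u n + v n"
  by (rule sq_summable_add)

lift_definition uminus_ell2 :: "ell2 \<Rightarrow> ell2" is "\<lambda>u n. - u n" by simp

lift_definition minus_ell2 :: "ell2 \<Rightarrow> ell2 \<Rightarrow> ell2" is "\<lambda>u v n. u n - v n"
  subgoal for u v using sq_summable_add[of u "\<lambda>n. - v n"] by simp
  done

lift_definition scaleR_ell2 :: "real \<Rightarrow> ell2 \<Rightarrow> ell2" is "\<lambda>r u n. complex_of_real r * u n"
  by (rule sq_summable_mult) auto

instance
  by standard (transfer; simp add: algebra_simps)+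

end

instantiation ell2 :: scaleC
begin

lift_definition scaleC_ell2 :: "complex \<Rightarrow> ell2 \<Rightarrow> ell2" is "\<lambda>z u n. z * u n"
  by (rule sq_summable_mult) auto

instance ..

end

lemmas ell2_nth_simps [simp] = zero_ell2.rep_eq plus_ell2.rep_eq uminus_ell2.rep_eq
  minus_ell2.rep_eq scaleR_ell2.rep_eq scaleC_ell2.rep_eq

instantiation ell2 :: real_inner
begin

definition inner_ell2 :: "ell2 \<Rightarrow> ell2 \<Rightarrow> real"
  where "inner_ell2 u v = Re (\<Sum>\<^sub>\<infinity>n. ell2_nth u n * cnj (ell2_nth v n))"

definition norm_ell2 :: "ell2 \<Rightarrow> real"
  where "norm_ell2 u = sqrt (\<Sum>\<^sub>\<infinity>n. (norm (ell2_nth u n))\<^sup>2)"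

definition sgn_ell2 :: "ell2 \<Rightarrow> ell2" where "sgn_ell2 u = u /\<^sub>R norm u"

definition dist_ell2 :: "ell2 \<Rightarrow> ell2 \<Rightarrow> real" where "dist_ell2 u v = norm (u - v)"

definition uniformity_ell2 :: "(ell2 \<times> ell2) filter"
  where "uniformity_ell2 = (INF e\<in>{0<..}. principal {(x, y). dist x y < e})"

definition open_ell2 :: "ell2 set \<Rightarrow> bool"
  where "open_ell2 U \<longleftrightarrow> (\<forall>x\<in>U. \<forall>\<^sub>F (x', y) in uniformity. x' = x \<longrightarrow> y \<in> U)"

instance
proof
  fix x y z :: ell2 and r :: real
  have self: "inner x x = (\<Sum>\<^sub>\<infinity>n. (norm (ell2_nth x n))\<^sup>2)" for x :: ell2
    unfolding inner_ell2_def infsum_Re[OF ell2_product_summable, symmetric]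
    by (simp add: cmod_power2) (simp add: power2_eq_square)
  show "inner x y = inner y x"
    unfolding inner_ell2_def infsum_Re[OF ell2_product_summable, symmetric]
    by (simp add: mult.commute)
  show "inner (x + y) z = inner x z + inner y z"
    by (simp add: inner_ell2_def distrib_right infsum_add ell2_product_summable)
  show "inner (r *\<^sub>R x) y = r * inner x y"
    by (simp add: inner_ell2_def mult.assoc infsum_cmult_right')
  show "0 \<le> inner x x" by (simp add: self infsum_nonneg)
  show "inner x x = 0 \<longleftrightarrow> x = 0"
  proof
    assume "inner x x = 0"
    then have "(norm (ell2_nth x n))\<^sup>2 = 0" for n
      using nonneg_infsum_le_0D[OF _ ell2_summable[of x], of n] by (simp add: self)
    then show "x = 0" by (intro ell2_eqI) simp
  qed (simp add: self)
  show "norm x = sqrt (inner x x)" by (simp add: self norm_ell2_def)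
qed (simp_all add: sgn_ell2_def dist_ell2_def uniformity_ell2_def open_ell2_def)

end

lemma norm_ell2_sq: "(norm u)\<^sup>2 = (\<Sum>\<^sub>\<infinity>n. (norm (ell2_nth u n))\<^sup>2)"
  by (simp add: norm_ell2_def infsum_nonneg)

lemma finite_sum_le_norm_ell2: "finite F \<Longrightarrow> (\<Sum>n\<in>F. (norm (ell2_nth u n))\<^sup>2) \<le> (norm u)\<^sup>2"
  unfolding norm_ell2_sq by (rule finite_sum_le_infsum) (auto simp: ell2_summable)

lemma norm_ell2_nth_le: "norm (ell2_nth u n) \<le> norm u"
  by (rule power2_le_imp_le) (use finite_sum_le_norm_ell2[of "{n}" u] in auto)

instance ell2 :: banach
proof
  fix X :: "nat \<Rightarrow> ell2"
  assume X: "Cauchy X"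
  have "Cauchy (\<lambda>k. ell2_nth (X k) n)" for n
  proof (rule metric_CauchyI)
    fix e :: real
    assume "e > 0"
    then obtain M where M: "\<And>k m. k \<ge> M \<Longrightarrow> m \<ge> M \<Longrightarrow> dist (X k) (X m) < e"
      using X by (meson metric_CauchyD)
    have "dist (ell2_nth (X k) n) (ell2_nth (X m) n) \<le> dist (X k) (X m)" for k m
      using norm_ell2_nth_le[of "X k - X m" n] by (simp add: dist_norm)
    then show "\<exists>M. \<forall>m\<ge>M. \<forall>k\<ge>M. dist (ell2_nth (X m) n) (ell2_nth (X k) n) < e"
      using M by (meson le_less_trans)
  qed
  then have "\<forall>n. \<exists>l. (\<lambda>k. ell2_nth (X k) n) \<longlonglongrightarrow> l"
    by (simp add: Cauchy_convergent_iff convergent_def)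
  from choice[OF this] obtain x where x: "\<And>n. (\<lambda>k. ell2_nth (X k) n) \<longlonglongrightarrow> x n"
    by blast
  have fin: "(\<Sum>n\<in>F. (norm (ell2_nth (X k) n - x n))\<^sup>2) \<le> e\<^sup>2"
    if "finite F" and "\<And>m. m \<ge> M \<Longrightarrow> norm (X k - X m) \<le> e" for F k M e
  proof (rule LIMSEQ_le_const2)
    show "(\<lambda>m. \<Sum>n\<in>F. (norm (ell2_nth (X k) n - ell2_nth (X m) n))\<^sup>2)
        \<longlonglongrightarrow> (\<Sum>n\<in>F. (norm (ell2_nth (X k) n - x n))\<^sup>2)"
      by (intro tendsto_intros x)
    show "\<exists>N. \<forall>m\<ge>N. (\<Sum>n\<in>F. (norm (ell2_nth (X k) n - ell2_nth (X m) n))\<^sup>2) \<le> e\<^sup>2"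
    proof (intro exI allI impI)
      fix m assume "m \<ge> M"
      then have "(norm (X k - X m))\<^sup>2 \<le> e\<^sup>2" using that(2) by (simp add: power_mono)
      then show "(\<Sum>n\<in>F. (norm (ell2_nth (X k) n - ell2_nth (X m) n))\<^sup>2) \<le> e\<^sup>2"
        using finite_sum_le_norm_ell2[OF that(1), of "X k - X m"] by simp
    qed
  qed
  have summ: "(\<lambda>n. (norm (ell2_nth (X k) n - x n))\<^sup>2) summable_on UNIV"
    if "\<And>m. m \<ge> M \<Longrightarrow> norm (X k - X m) \<le> e" for k M e
    by (rule nonneg_bdd_above_summable_on) (auto intro!: bdd_aboveI2 fin that)
  obtain M1 where "\<And>k m. k \<ge> M1 \<Longrightarrow> m \<ge> M1 \<Longrightarrow> norm (X k - X m) < 1"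
    using X by (metis CauchyD zero_less_one)
  then have "(\<lambda>n. (norm (ell2_nth (X M1) n - x n))\<^sup>2) summable_on UNIV"
    by (intro summ[of M1 M1 1]) (simp add: less_imp_le)
  then have "(\<lambda>n. (norm (- (ell2_nth (X M1) n - x n) + ell2_nth (X M1) n))\<^sup>2) summable_on UNIV"
    by (intro sq_summable_add ell2_summable) (simp add: norm_minus_commute)
  then have nth: "ell2_nth (Abs_ell2 x) = x"
    by (intro Abs_ell2_inverse) simp
  have "X \<longlonglongrightarrow> Abs_ell2 x"
  proof (rule metric_LIMSEQ_I)
    fix e :: real
    assume e: "e > 0"
    then obtain M where M: "\<And>k m. k \<ge> M \<Longrightarrow> m \<ge> M \<Longrightarrow> norm (X k - X m) < e / 2"
      using X by (metis CauchyD half_gt_zero)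
    have "dist (X k) (Abs_ell2 x) < e" if "k \<ge> M" for k
    proof -
      have *: "norm (X k - X m) \<le> e / 2" if "m \<ge> M" for m
        using M[OF \<open>k \<ge> M\<close> that] by simp
      have "(norm (X k - Abs_ell2 x))\<^sup>2 \<le> (e / 2)\<^sup>2"
        unfolding norm_ell2_sq
      proof (rule infsum_le_finite_sums[OF ell2_summable])
        fix F :: "int set"
        assume "finite F"
        from fin[OF this *]
        show "(\<Sum>n\<in>F. (norm (ell2_nth (X k - Abs_ell2 x) n))\<^sup>2) \<le> (e / 2)\<^sup>2"
          by (simp add: nth)
      qed
      then have "norm (X k - Abs_ell2 x) \<le> e / 2"
        by (rule power2_le_imp_le) (use e in simp)
      then show ?thesis using e by (simp add: dist_norm)
    qed
    then show "\<exists>M. \<forall>k\<ge>M. dist (X k) (Abs_ell2 x) < e" by blast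
  qed
  then show "convergent X" by (auto simp: convergent_def)
qed

instantiation ell2 :: complex_hilbert
begin

definition cinner_ell2 :: "ell2 \<Rightarrow> ell2 \<Rightarrow> complex"
  where "cinner_ell2 u v = (\<Sum>\<^sub>\<infinity>n. ell2_nth u n * cnj (ell2_nth v n))"

instance
proof
  fix x y v :: ell2 and z w :: complex and r :: real
  show "z *\<^sub>C (x + y) = z *\<^sub>C x + z *\<^sub>C y" "(z + w) *\<^sub>C x = z *\<^sub>C x + w *\<^sub>C x"
    "z *\<^sub>C w *\<^sub>C x = (z * w) *\<^sub>C x" "complex_of_real r *\<^sub>C x = r *\<^sub>R x"
    by (intro ell2_eqI; simp add: algebra_simps)+
  show "cinner x y = cnj (cinner y x)"
    by (simp add: cinner_ell2_def flip: infsum_cnj) (simp add: mult.commute)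
  show "cinner (x + y) v = cinner x v + cinner y v"
    by (simp add: cinner_ell2_def distrib_right infsum_add ell2_product_summable)
  show "cinner (z *\<^sub>C x) y = z * cinner x y"
    by (simp add: cinner_ell2_def mult.assoc infsum_cmult_right')
  show "x \<bullet> y = Re (cinner x y)"
    by (simp add: cinner_ell2_def inner_ell2_def)
qed

end

section \<open>Periodic Jacobi operators\<close>

text \<open>
  For periodic (indeed for bounded) coefficients the defining sequence is square-summable;
  see \<open>ell2_nth_jacobi\<close> and \<open>bounded_clinear_jacobi\<close> below. Otherwise
  \<open>Abs_ell2\<close> may be applied outside its domain.
\<close>

definition jacobi :: "(int \<Rightarrow> real) \<Rightarrow> (int \<Rightarrow> real) \<Rightarrow> (int \<Rightarrow> real) \<Rightarrow> ell2 \<Rightarrow> ell2"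
  where "jacobi a b c u = Abs_ell2 (\<lambda>n.
    complex_of_real (c (n - 1)) * ell2_nth u (n - 1)
    + complex_of_real (a n) * ell2_nth u n
    + complex_of_real (b n) * ell2_nth u (n + 1))"

definition periodic :: "nat \<Rightarrow> (int \<Rightarrow> real) \<Rightarrow> bool"
  where "periodic p a \<longleftrightarrow> (\<forall>i. a (i + int p) = a i)"

text \<open>For periodic \<open>a\<close> with positive period the set is finite (\<open>finite_differences\<close> below), so that \<^const>\<open>Max\<close> is its maximum.\<close>

definition osc :: "(int \<Rightarrow> real) \<Rightarrow> real"
  where "osc a = Max {\<bar>a (int i) - a (int j)\<bar> | i j. True}"

lemma periodic_mod:
  assumes "periodic p a"
  shows "a i = a (i mod int p)"
proof -
  have *: "a (j + int k * int p) = a j" for j k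
  proof (induction k)
    case (Suc k)
    have "a (j + int (Suc k) * int p) = a ((j + int k * int p) + int p)"
      by (simp add: algebra_simps)
    also have "\<dots> = a j" using Suc assms by (simp add: periodic_def)
    finally show ?case .
  qed simp
  have pos: "a (j + m * int p) = a j" if "m \<ge> 0" for j m
    using *[of j "nat m"] that by simp
  have "a (j + m * int p) = a j" for j m
  proof (cases "m \<ge> 0")
    case False
    then show ?thesis using pos[of "- m" "j + m * int p"] by simp
  qed (rule pos)
  from this[of "i mod int p" "i div int p"] show ?thesis by simp
qed

lemma finite_range_periodic:
  assumes "periodic p a" and "p \<ge> 1"
  shows "finite (range a)"
proof (rule finite_subset)
  show "range a \<subseteq> a ` {0..<int p}"
    using periodic_mod[OF assms(1)] assms(2) by (force simp: image_iff)
qed simp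

lemma finite_differences:
  assumes "periodic p a" and "p \<ge> 1"
  shows "finite {\<bar>a (int i) - a (int j)\<bar> | i j. True}"
proof (rule finite_subset)
  show "{\<bar>a (int i) - a (int j)\<bar> | i j. True} \<subseteq> (\<lambda>(x, y). \<bar>x - y\<bar>) ` (range a \<times> range a)"
    by (force simp: image_iff)
qed (simp add: finite_range_periodic[OF assms])

lemma periodic_bounded:
  assumes "periodic p a" and "p \<ge> 1"
  obtains C where "\<And>n. norm (complex_of_real (a n)) \<le> C"
proof -
  have "bounded (range a)" using finite_range_periodic[OF assms] by (rule finite_imp_bounded)
  then show ?thesis using that by (auto simp: bounded_iff)
qed

lemma ell2_nth_jacobi:
  assumes "periodic p a" "periodic p b" "periodic p c" and "p \<ge> 1"
  shows "ell2_nth (jacobi a b c u) n =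
    complex_of_real (c (n - 1)) * ell2_nth u (n - 1)
    + complex_of_real (a n) * ell2_nth u n
    + complex_of_real (b n) * ell2_nth u (n + 1)"
proof -
  obtain A where A: "\<And>n. norm (complex_of_real (a n)) \<le> A"
    using periodic_bounded assms(1,4) by blast
  obtain B where B: "\<And>n. norm (complex_of_real (b n)) \<le> B"
    using periodic_bounded assms(2,4) by blast
  obtain C where C: "\<And>n. norm (complex_of_real (c n)) \<le> C"
    using periodic_bounded assms(3,4) by blast
  have l: "(\<lambda>n. (norm (ell2_nth u (n - 1)))\<^sup>2) summable_on UNIV"
    using sq_summable_shift[OF ell2_summable, of u "- 1"] by simp
  have "(\<lambda>n. (norm (complex_of_real (c (n - 1)) * ell2_nth u (n - 1)
    + complex_of_real (a n) * ell2_nth u n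
    + complex_of_real (b n) * ell2_nth u (n + 1)))\<^sup>2) summable_on UNIV"
    by (rule sq_summable_add[OF sq_summable_add[OF sq_summable_mult[OF l C]
          sq_summable_mult[OF ell2_summable A]]
          sq_summable_mult[OF sq_summable_shift[OF ell2_summable] B]])
  then show ?thesis unfolding jacobi_def by (subst Abs_ell2_inverse) auto
qed

lemma bounded_clinear_jacobi:
  assumes "periodic p a" "periodic p b" "periodic p c" and "p \<ge> 1"
  shows "bounded_clinear (jacobi a b c)"
proof -
  note nth [simp] = ell2_nth_jacobi[OF assms]
  obtain A where A: "\<And>n. norm (complex_of_real (a n)) \<le> A"
    using periodic_bounded assms(1,4) by blast
  obtain B where B: "\<And>n. norm (complex_of_real (b n)) \<le> B"
    using periodic_bounded assms(2,4) by blast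
  obtain C where C: "\<And>n. norm (complex_of_real (c n)) \<le> C"
    using periodic_bounded assms(3,4) by blast
  define K where "K = 4 * C\<^sup>2 + 4 * A\<^sup>2 + 2 * B\<^sup>2"
  have "norm (jacobi a b c u) \<le> norm u * sqrt K" for u
  proof -
    let ?u = "\<lambda>n. (norm (ell2_nth u n))\<^sup>2"
    have s: "(\<lambda>n. ?u (n + k)) summable_on UNIV" for k
      by (rule sq_summable_shift[OF ell2_summable])
    have sq: "(norm (complex_of_real x * y))\<^sup>2 \<le> D\<^sup>2 * (norm y)\<^sup>2"
      if "norm (complex_of_real x) \<le> D" for x y D
      using that power_mono[OF that, of 2]
      by (simp add: norm_mult power_mult_distrib mult_right_mono)
    have s1: "(\<lambda>n. 4 * C\<^sup>2 * ?u (n + (- 1))) summable_on UNIV"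
      "(\<lambda>n. 4 * A\<^sup>2 * ?u (n + 0)) summable_on UNIV"
      "(\<lambda>n. 2 * B\<^sup>2 * ?u (n + 1)) summable_on UNIV"
      by (rule summable_on_cmult_right, rule s)+
    have "(norm (jacobi a b c u))\<^sup>2 \<le>
      (\<Sum>\<^sub>\<infinity>n. (4 * C\<^sup>2 * ?u (n + (- 1)) + 4 * A\<^sup>2 * ?u (n + 0)) + 2 * B\<^sup>2 * ?u (n + 1))"
      unfolding norm_ell2_sq
    proof (rule infsum_mono)
      fix n
      show "(norm (ell2_nth (jacobi a b c u) n))\<^sup>2 \<le>
        (4 * C\<^sup>2 * ?u (n + (- 1)) + 4 * A\<^sup>2 * ?u (n + 0)) + 2 * B\<^sup>2 * ?u (n + 1)"
        using sq[OF C, of "n - 1" "ell2_nth u (n - 1)"] sq[OF A, of n "ell2_nth u n"]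
          sq[OF B, of n "ell2_nth u (n + 1)"]
          norm_add_sq_le[of "complex_of_real (c (n - 1)) * ell2_nth u (n - 1)"
            "complex_of_real (a n) * ell2_nth u n"]
          norm_add_sq_le[of "complex_of_real (c (n - 1)) * ell2_nth u (n - 1)
            + complex_of_real (a n) * ell2_nth u n"
            "complex_of_real (b n) * ell2_nth u (n + 1)"]
        by simp
    qed (rule ell2_summable summable_on_add[OF summable_on_add[OF s1(1,2)] s1(3)])+
    also have "\<dots> = 4 * C\<^sup>2 * (norm u)\<^sup>2 + 4 * A\<^sup>2 * (norm u)\<^sup>2 + 2 * B\<^sup>2 * (norm u)\<^sup>2"
      unfolding infsum_add[OF summable_on_add[OF s1(1,2)] s1(3)] infsum_add[OF s1(1,2)]
        infsum_cmult_right' sq_infsum_shift norm_ell2_sq ..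
    finally have "(norm (jacobi a b c u))\<^sup>2 \<le> (norm u)\<^sup>2 * K"
      by (simp add: K_def algebra_simps)
    then have "norm (jacobi a b c u) \<le> sqrt ((norm u)\<^sup>2 * K)"
      by (rule real_le_rsqrt)
    then show ?thesis by (simp add: real_sqrt_mult)
  qed
  moreover have "jacobi a b c (u + v) = jacobi a b c u + jacobi a b c v" for u v
    by (intro ell2_eqI) (simp add: algebra_simps)
  moreover have "jacobi a b c (r *\<^sub>R u) = r *\<^sub>R jacobi a b c u" for r u
    by (intro ell2_eqI) (simp add: algebra_simps)
  moreover have "jacobi a b c (z *\<^sub>C u) = z *\<^sub>C jacobi a b c u" for z u
    by (intro ell2_eqI) (simp add: algebra_simps)
  ultimately show ?thesis
    unfolding bounded_clinear_def by (blast intro: bounded_linear_intro)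
qed

end

theory Submission
  imports Defs
begin

text \<open>
  \<open>J\<close> differs by norm at most \<open>\<bar>b - c\<bar>\<close> from the self-adjoint Jacobi operator \<open>H\<close> with both
  off-diagonals equal to \<open>(b + c) / 2\<close>. Deleting the sites \<open>n + p \<int>\<close> from \<open>H\<close> leaves copies of one
  block of size \<open>p - 1\<close> with eigenvalues \<open>\<mu>\<^sub>1(n) \<le> \<dots> \<le> \<mu>\<^sub>p\<^sub>-\<^sub>1(n)\<close> and trace \<open>a\<^sub>1 + \<dots> + a\<^sub>p - a\<^sub>n\<close>.
  If \<open>a\<^sub>n - a\<^sub>m > 2 \<eta> (p - 1)\<close> with \<open>\<eta> = \<epsilon> + \<bar>b - c\<bar>\<close>, some \<open>i\<close> has \<open>\<mu>\<^sub>i(m) - \<mu>\<^sub>i(n) > 2 \<eta>\<close>, and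
  \<open>H\<close> has no spectrum strictly between \<open>\<mu>\<^sub>i(n)\<close> and \<open>\<mu>\<^sub>i(m)\<close>: on a ring of \<open>N\<close> periods, the low
  eigenvectors of the \<open>n\<close>-blocks and the high ones of the \<open>m\<close>-blocks span everything by a dimension
  count. The vertical line through the midpoint then avoids \<open>\<Lambda>\<^sub>\<epsilon>(J)\<close>, while the extreme points of
  the spectrum of \<open>H\<close> lie in \<open>\<Lambda>\<^sub>\<epsilon>(J)\<close> on both sides of it.
\<close>

section \<open>Symmetric operators on finite-dimensional subspaces\<close>

definition orthonormal_on :: "('i \<Rightarrow> 'a::real_inner) \<Rightarrow> 'i set \<Rightarrow> bool"
  where "orthonormal_on f I \<longleftrightarrow> (\<forall>i\<in>I. \<forall>j\<in>I. f i \<bullet> f j = of_bool (i = j))"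

lemma orthonormal_onD:
  assumes "orthonormal_on f I" "i \<in> I" "j \<in> I"
  shows "f i \<bullet> f j = of_bool (i = j)"
  using assms by (simp add: orthonormal_on_def)

lemma orthonormal_sum_inner:
  assumes "orthonormal_on f I" "finite I" "i \<in> I"
  shows "(\<Sum>j\<in>I. t j *\<^sub>R f j) \<bullet> f i = t i"
proof -
  have "(\<Sum>j\<in>I. t j *\<^sub>R f j) \<bullet> f i = (\<Sum>j\<in>I. t j * of_bool (j = i))"
    by (simp add: inner_sum_left orthonormal_onD[OF assms(1) _ assms(3)])
  then show ?thesis using assms(2,3) by (simp add: sum.delta flip: of_bool_def)
qed

lemma orthonormal_inj:
  assumes "orthonormal_on f I"
  shows "inj_on f I"
proof (rule inj_onI)
  fix i j assume "i \<in> I" "j \<in> I" "f i = f j"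
  then show "i = j"
    using orthonormal_onD[OF assms(1), of i j] orthonormal_onD[OF assms(1), of i i]
    by (auto split: if_splits simp: of_bool_def)
qed

lemma orthonormal_expansion:
  assumes "orthonormal_on f I" "finite I" "x \<in> span (f ` I)"
  shows "x = (\<Sum>i\<in>I. (x \<bullet> f i) *\<^sub>R f i)"
proof -
  obtain r where r: "x = (\<Sum>v\<in>f ` I. r v *\<^sub>R v)"
    using assms(2,3) by (auto simp: span_finite)
  note inj = orthonormal_inj[OF assms(1)]
  have x: "x = (\<Sum>i\<in>I. r (f i) *\<^sub>R f i)"
    using r sum.reindex[OF inj, of "\<lambda>v. r v *\<^sub>R v"] by simp
  have "x \<bullet> f i = r (f i)" if "i \<in> I" for i
    unfolding x by (rule orthonormal_sum_inner[OF assms(1,2) that])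
  then show ?thesis by (subst x) simp
qed

lemma orthonormal_inner_expansion:
  assumes "orthonormal_on f I" "finite I" "x \<in> span (f ` I)"
  shows "x \<bullet> y = (\<Sum>i\<in>I. (x \<bullet> f i) * (f i \<bullet> y))"
  by (subst orthonormal_expansion[OF assms]) (simp add: inner_sum_left)

lemma orthonormal_independent:
  assumes "orthonormal_on f I" "finite I"
  shows "independent (f ` I)"
proof (rule independent_if_scalars_zero)
  fix g v assume *: "(\<Sum>x\<in>f ` I. g x *\<^sub>R x) = 0" "v \<in> f ` I"
  then obtain i where i: "i \<in> I" "v = f i" by blast
  have "(\<Sum>j\<in>I. g (f j) *\<^sub>R f j) = 0"
    using * sum.reindex[OF orthonormal_inj[OF assms(1)], of "\<lambda>v. g v *\<^sub>R v"] by simp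
  then show "g v = 0"
    using orthonormal_sum_inner[OF assms i(1), of "\<lambda>j. g (f j)"] i by simp
qed (use assms in auto)

text \<open>A dimension count inside an infinite-dimensional space: an element of \<open>B\<close>
  outside \<open>span S\<close> would extend \<open>S\<close> to an independent subset of
  \<open>span B\<close> with more than \<open>card B\<close> elements.\<close>

lemma span_eq_if_card_ge:
  fixes S B :: "'a::real_vector set"
  assumes "independent S" "S \<subseteq> span B" "finite B" "card B \<le> card S"
  shows "span S = span B"
proof
  show "span S \<subseteq> span B" using assms(2) by (simp add: span_minimal)
  have "B \<subseteq> span S"
  proof
    fix b assume b: "b \<in> B"
    show "b \<in> span S"
    proof (rule ccontr)
      assume nb: "b \<notin> span S"
      then have "independent (insert b S)" using assms(1) by (simp add: independent_insert)
      moreover have "insert b S \<subseteq> span B" using assms(2) b by (simp add: span_base)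
      ultimately have "finite (insert b S) \<and> card (insert b S) \<le> card B"
        by (rule independent_span_bound[OF assms(3)])
      moreover have "b \<notin> S" using nb span_base by blast
      ultimately show False using assms(4) by (auto simp: card_insert_if)
    qed
  qed
  then show "span B \<subseteq> span S" by (simp add: span_minimal)
qed

text \<open>Unit vectors have coordinates in [-1, 1], so the sphere is a closed part of a continuous
  image of a cube; that image is built one coordinate at a time.\<close>

lemma compact_sphere_span:
  fixes f :: "'i \<Rightarrow> 'a::real_inner"
  assumes "orthonormal_on f I" "finite I"
  shows "compact {x \<in> span (f ` I). norm x = 1}"
proof -
  have "\<exists>K. compact K \<and> K \<subseteq> span (f ` J) \<and>
      (\<forall>t. (\<forall>i\<in>J. \<bar>t i\<bar> \<le> 1) \<longrightarrow> (\<Sum>i\<in>J. t i *\<^sub>R f i) \<in> K)" if "finite J" for J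
    using that
  proof induction
    case empty
    show ?case by (intro exI[of _ "{0}"]) auto
  next
    case (insert j J)
    then obtain K where K: "compact K" "K \<subseteq> span (f ` J)"
      "\<And>t. (\<forall>i\<in>J. \<bar>t i\<bar> \<le> 1) \<Longrightarrow> (\<Sum>i\<in>J. t i *\<^sub>R f i) \<in> K" by blast
    let ?K = "(\<lambda>(s, y). s *\<^sub>R f j + y) ` ({-1..1} \<times> K)"
    have "compact ?K"
      by (intro compact_continuous_image compact_Times K compact_Icc)
         (auto simp: case_prod_unfold intro!: continuous_intros)
    moreover have "?K \<subseteq> span (f ` insert j J)"
    proof clarsimp
      fix s :: real and y assume "y \<in> K"
      then have "y \<in> span (insert (f j) (f ` J))"
        using K(2) span_mono[of "f ` J" "insert (f j) (f ` J)"] by blast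
      then show "s *\<^sub>R f j + y \<in> span (insert (f j) (f ` J))"
        by (intro span_add span_scale) (auto intro: span_base)
    qed
    moreover have "(\<Sum>i\<in>insert j J. t i *\<^sub>R f i) \<in> ?K" if "\<forall>i\<in>insert j J. \<bar>t i\<bar> \<le> 1" for t
      using K(3)[of t] that insert.hyps
      by (intro image_eqI[of _ _ "(t j, \<Sum>i\<in>J. t i *\<^sub>R f i)"]) auto
    ultimately show ?case by blast
  qed
  from this[OF assms(2)] obtain K where K: "compact K" "K \<subseteq> span (f ` I)"
      "\<And>t. (\<forall>i\<in>I. \<bar>t i\<bar> \<le> 1) \<Longrightarrow> (\<Sum>i\<in>I. t i *\<^sub>R f i) \<in> K" by blast
  have "x \<in> K" if "x \<in> span (f ` I)" "norm x = 1" for x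
  proof -
    have "\<bar>x \<bullet> f i\<bar> \<le> 1" if "i \<in> I" for i
      using Cauchy_Schwarz_ineq2[of x "f i"] orthonormal_onD[OF assms(1) that that] \<open>norm x = 1\<close>
      by (simp add: norm_eq_sqrt_inner)
    then show ?thesis
      using K(3)[of "\<lambda>i. x \<bullet> f i"] orthonormal_expansion[OF assms that(1)] by simp
  qed
  then have "{x \<in> span (f ` I). norm x = 1} = K \<inter> {x. norm x = 1}"
    using K(2) by auto
  moreover have "closed {x :: 'a. norm x = 1}" by (intro closed_Collect_eq continuous_intros)
  ultimately show ?thesis using compact_Int_closed[OF K(1)] by simp
qed

text \<open>One step of the variational construction of eigenvectors: the Rayleigh quotient is
  minimized over the unit vectors of the subspace orthogonal to those already found, a compact set,
  nonempty because \<open>k < card I\<close>.\<close>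

lemma rayleigh_minimizer:
  fixes H :: "'a::real_inner \<Rightarrow> 'a" and e :: "nat \<Rightarrow> 'a"
  assumes f: "orthonormal_on f I" "finite I" and H: "bounded_linear H"
    and e: "orthonormal_on e {..<k}" "\<And>i. i < k \<Longrightarrow> e i \<in> span (f ` I)" and k: "k < card I"
  obtains v where "v \<in> span (f ` I)" "norm v = 1" "\<And>i. i < k \<Longrightarrow> v \<bullet> e i = 0"
    "\<And>y. y \<in> span (f ` I) \<Longrightarrow> (\<And>i. i < k \<Longrightarrow> y \<bullet> e i = 0) \<Longrightarrow> (v \<bullet> H v) * (y \<bullet> y) \<le> y \<bullet> H y"
proof -
  interpret H: bounded_linear H by (rule H)
  let ?V = "span (f ` I)"
  let ?C = "{x \<in> ?V. norm x = 1} \<inter> (\<Inter>i<k. {x. x \<bullet> e i = 0})"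
  have "closed (\<Inter>i<k. {x. x \<bullet> e i = 0})"
    by (intro closed_INT ballI closed_Collect_eq continuous_intros)
  then have C: "compact ?C" by (rule compact_Int_closed[OF compact_sphere_span[OF f]])
  have "\<not> f ` I \<subseteq> span (e ` {..<k})"
  proof
    assume "f ` I \<subseteq> span (e ` {..<k})"
    from independent_span_bound[OF _ orthonormal_independent[OF f] this]
    have "card (f ` I) \<le> card (e ` {..<k})" by simp
    also have "\<dots> \<le> k" using card_image_le[of "{..<k}" e] by simp
    finally show False using k by (simp add: card_image[OF orthonormal_inj[OF f(1)]])
  qed
  then obtain b where b: "b \<in> f ` I" "b \<notin> span (e ` {..<k})" by blast
  define x where "x = b - (\<Sum>i<k. (b \<bullet> e i) *\<^sub>R e i)"
  have sp: "(\<Sum>i<k. (b \<bullet> e i) *\<^sub>R e i) \<in> span (e ` {..<k})"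
    by (intro span_sum span_scale span_base) auto
  then have x0: "x \<noteq> 0" using b(2) by (auto simp: x_def)
  have xo: "x \<bullet> e i = 0" if "i < k" for i
    using orthonormal_sum_inner[OF e(1), of i "\<lambda>i. b \<bullet> e i"] that
    by (simp add: x_def inner_diff_left)
  have "x \<in> ?V"
    unfolding x_def using b(1) e(2) by (intro span_diff span_sum span_scale) (auto intro: span_base)
  then have "(1 / norm x) *\<^sub>R x \<in> ?C"
    using x0 xo by (auto simp: span_scale)
  then have "?C \<noteq> {}" by blast
  moreover have "continuous_on ?C (\<lambda>x. x \<bullet> H x)"
    by (intro continuous_intros H.continuous_on)
  ultimately have "\<exists>v\<in>?C. \<forall>y\<in>?C. v \<bullet> H v \<le> y \<bullet> H y"
    by (intro continuous_attains_inf C)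
  then obtain v where v: "v \<in> ?C" "\<And>y. y \<in> ?C \<Longrightarrow> v \<bullet> H v \<le> y \<bullet> H y"
    by (elim bexE) (rule that, assumption, erule bspec)
  show ?thesis
  proof
    show "v \<in> ?V" "norm v = 1" "\<And>i. i < k \<Longrightarrow> v \<bullet> e i = 0" using v(1) by auto
    fix y assume y: "y \<in> ?V" "\<And>i. i < k \<Longrightarrow> y \<bullet> e i = 0"
    show "(v \<bullet> H v) * (y \<bullet> y) \<le> y \<bullet> H y"
    proof (cases "y = 0")
      case False
      have "(1 / norm y) *\<^sub>R y \<in> ?C" using y False by (auto simp: span_scale)
      from v(2)[OF this] have "v \<bullet> H v \<le> (y \<bullet> H y) / (norm y)\<^sup>2"
        by (simp add: H.scaleR power2_eq_square)
      then show ?thesis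
        using False by (simp add: pos_le_divide_eq power2_norm_eq_inner)
    qed (simp add: H.zero)
  qed
qed

lemma linear_coeff_zero:
  fixes c D :: real
  assumes "\<And>t. 0 \<le> 2 * t * c + t\<^sup>2 * D"
  shows "c = 0"
proof (rule ccontr)
  assume c: "c \<noteq> 0"
  \<comment> \<open>The choice gives \<open>s * D < 1\<close>, so that at \<open>t = - s * c\<close>
    the expression equals \<open>(s * c\<^sup>2) * (s * D - 2)\<close>, which is negative.\<close>
  define s where "s = 1 / (\<bar>D\<bar> + 1)"
  have s: "s > 0" "s * D < 1" by (auto simp: s_def divide_simps)
  have "0 \<le> 2 * (- s * c) * c + (- s * c)\<^sup>2 * D" by (rule assms)
  also have "\<dots> = (s * c\<^sup>2) * (s * D - 2)" by (simp add: power2_eq_square algebra_simps)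
  also have "\<dots> < 0" using s c by (intro mult_pos_neg) auto
  finally show False by simp
qed

text \<open>Successive minimization of the Rayleigh quotient diagonalizes the compression of
  \<open>H\<close> to the span, which \<open>H\<close> itself may leave. The values are ordered
  because each minimum is taken over a smaller set.\<close>

lemma symmetric_diagonalization:
  fixes H :: "'a::real_inner \<Rightarrow> 'a"
  assumes f: "orthonormal_on f I" "finite I" and H: "bounded_linear H"
    and sym: "\<And>u v. u \<bullet> H v = H u \<bullet> v"
  obtains e :: "nat \<Rightarrow> 'a" and \<alpha> :: "nat \<Rightarrow> real"
  where "orthonormal_on e {..<card I}" "\<And>i. i < card I \<Longrightarrow> e i \<in> span (f ` I)"
    "\<And>i j. i < card I \<Longrightarrow> j < card I \<Longrightarrow> e i \<bullet> H (e j) = \<alpha> i * of_bool (i = j)"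
    "\<And>i j. i \<le> j \<Longrightarrow> j < card I \<Longrightarrow> \<alpha> i \<le> \<alpha> j"
    "(\<Sum>i<card I. \<alpha> i) = (\<Sum>i\<in>I. f i \<bullet> H (f i))"
proof -
  interpret H: bounded_linear H by (rule H)
  let ?V = "span (f ` I)"
  let ?P = "\<lambda>k e. orthonormal_on e {..<k} \<and> (\<forall>i<k. e i \<in> ?V) \<and>
    (\<forall>i<k. \<forall>y\<in>?V. (\<forall>j<i. y \<bullet> e j = 0) \<longrightarrow> (e i \<bullet> H (e i)) * (y \<bullet> y) \<le> y \<bullet> H y)"
  have "\<exists>e :: nat \<Rightarrow> 'a. ?P k e" if "k \<le> card I" for k
    using that
  proof (induction k)
    case 0
    show ?case by (auto simp: orthonormal_on_def)
  next
    case (Suc k)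
    then obtain e :: "nat \<Rightarrow> 'a" where e: "?P k e" by auto
    from Suc.prems have "k < card I" by simp
    with e obtain v where v: "v \<in> ?V" "norm v = 1" "\<And>i. i < k \<Longrightarrow> v \<bullet> e i = 0"
      "\<And>y. y \<in> ?V \<Longrightarrow> (\<And>i. i < k \<Longrightarrow> y \<bullet> e i = 0) \<Longrightarrow> (v \<bullet> H v) * (y \<bullet> y) \<le> y \<bullet> H y"
      using rayleigh_minimizer[OF f H, of e k] by metis
    let ?e = "e(k := v)"
    have "orthonormal_on ?e {..<Suc k}"
      using e v(2,3) by (auto simp: orthonormal_on_def less_Suc_eq norm_eq_1 inner_commute)
    moreover have "(\<forall>i<Suc k. ?e i \<in> ?V)" using e v(1) by (auto simp: less_Suc_eq)
    moreover have "(?e i \<bullet> H (?e i)) * (y \<bullet> y) \<le> y \<bullet> H y"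
      if "i < Suc k" "y \<in> ?V" "\<forall>j<i. y \<bullet> ?e j = 0" for i y
      using that e v(4)[of y] by (cases "i = k") auto
    ultimately show ?case by blast
  qed
  then obtain e where e: "?P (card I) e" by blast
  then have on: "orthonormal_on e {..<card I}" and eV: "\<And>i. i < card I \<Longrightarrow> e i \<in> ?V"
    and min: "\<And>i y. i < card I \<Longrightarrow> y \<in> ?V \<Longrightarrow> (\<And>j. j < i \<Longrightarrow> y \<bullet> e j = 0) \<Longrightarrow>
      (e i \<bullet> H (e i)) * (y \<bullet> y) \<le> y \<bullet> H y" by blast+
  have ee: "e i \<bullet> e j = of_bool (i = j)" if "i < card I" "j < card I" for i j
    using orthonormal_onD[OF on] that by simp
  define \<alpha> where "\<alpha> i = e i \<bullet> H (e i)" for i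
  have mono: "\<alpha> i \<le> \<alpha> j" if "i \<le> j" "j < card I" for i j
    using min[of i "e j"] that eV[of j] by (simp add: \<alpha>_def ee)
  \<comment> \<open>For \<open>j > i\<close> the perturbation of \<open>e i\<close> along
    \<open>e j\<close> still satisfies the constraints under which \<open>e i\<close> is minimal. A
    quadratic polynomial in \<open>t\<close> is therefore nonnegative, and its linear coefficient
    vanishes.\<close>
  have zero: "e i \<bullet> H (e j) = 0" if "i < j" "j < card I" for i j
  proof (rule linear_coeff_zero)
    fix t :: real
    let ?y = "e i + t *\<^sub>R e j"
    have "?y \<in> ?V" using that eV by (intro span_add span_scale) auto
    from min[OF _ this, of i] have 1: "\<alpha> i * (?y \<bullet> ?y) \<le> ?y \<bullet> H ?y"
      using that by (simp add: ee inner_add_left \<alpha>_def)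
    have 2: "?y \<bullet> ?y = 1 + t\<^sup>2"
      using that by (simp add: ee inner_add_left inner_add_right power2_eq_square)
    have 3: "?y \<bullet> H ?y = \<alpha> i + 2 * t * (e i \<bullet> H (e j)) + t\<^sup>2 * \<alpha> j"
      using sym[of "e j" "e i"]
      by (simp add: H.add H.scaleR \<alpha>_def power2_eq_square
            inner_commute[of "H (e j)"] algebra_simps)
    show "0 \<le> 2 * t * (e i \<bullet> H (e j)) + t\<^sup>2 * (\<alpha> j - \<alpha> i)"
      using 1[unfolded 2 3] by (simp add: algebra_simps)
  qed
  have diag: "e i \<bullet> H (e j) = \<alpha> i * of_bool (i = j)" if "i < card I" "j < card I" for i j
    using zero[of i j] zero[of j i] that sym[of "e i" "e j"]
    by (cases i j rule: linorder_cases) (auto simp: \<alpha>_def inner_commute)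
  have sp: "span (e ` {..<card I}) = ?V"
  proof (rule span_eq_if_card_ge[OF orthonormal_independent[OF on]])
    show "card (f ` I) \<le> card (e ` {..<card I})"
      using card_image[OF orthonormal_inj[OF on]] card_image[OF orthonormal_inj[OF f(1)]] by simp
  qed (use eV f in auto)
  \<comment> \<open>Basis independence of the trace: expand in \<open>f\<close>, exchange the sums,
    and sum up again in \<open>e\<close>.\<close>
  have "(\<Sum>i<card I. \<alpha> i) = (\<Sum>i<card I. \<Sum>l\<in>I. (e i \<bullet> f l) * (f l \<bullet> H (e i)))"
    unfolding \<alpha>_def using orthonormal_inner_expansion[OF f] eV by simp
  also have "\<dots> = (\<Sum>l\<in>I. \<Sum>i<card I. (e i \<bullet> f l) * (f l \<bullet> H (e i)))" by (rule sum.swap)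
  also have "\<dots> = (\<Sum>l\<in>I. f l \<bullet> H (f l))"
  proof (rule sum.cong[OF refl])
    fix l assume "l \<in> I"
    then have "f l \<in> span (e ` {..<card I})" unfolding sp by (auto intro: span_base)
    then have "f l \<bullet> H (f l) = (\<Sum>i<card I. (f l \<bullet> e i) * (e i \<bullet> H (f l)))"
      by (intro orthonormal_inner_expansion[OF on]) auto
    moreover have "e i \<bullet> H (f l) = f l \<bullet> H (e i)" for i
      using sym[of "e i" "f l"] by (simp add: inner_commute)
    ultimately show "(\<Sum>i<card I. (e i \<bullet> f l) * (f l \<bullet> H (e i))) = f l \<bullet> H (f l)"
      by (simp add: inner_commute)
  qed
  finally show ?thesis using that[OF on eV diag mono] by blast
qed

text \<open>\<open>X v\<close> may leave the span, but the part outside is orthogonal to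
  \<open>v\<close>; only the compression of \<open>X\<close> has to be diagonal.\<close>

lemma quadratic_form_diagonal:
  fixes X :: "'a::real_inner \<Rightarrow> 'a"
  assumes f: "orthonormal_on f I" "finite I" and X: "linear X"
    and off: "\<And>i j. i \<in> I \<Longrightarrow> j \<in> I \<Longrightarrow> i \<noteq> j \<Longrightarrow> f i \<bullet> X (f j) = 0"
    and v: "v \<in> span (f ` I)"
  shows "v \<bullet> X v = (\<Sum>i\<in>I. (v \<bullet> f i)\<^sup>2 * (f i \<bullet> X (f i)))"
proof -
  interpret X: linear X by (rule X)
  have "f i \<bullet> X v = (v \<bullet> f i) * (f i \<bullet> X (f i))" if i: "i \<in> I" for i
  proof -
    have "f i \<bullet> X v = f i \<bullet> X (\<Sum>j\<in>I. (v \<bullet> f j) *\<^sub>R f j)"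
      using orthonormal_expansion[OF f v] by simp
    also have "\<dots> = (\<Sum>j\<in>I. (v \<bullet> f j) * (f i \<bullet> X (f j)))"
      by (simp add: X.sum X.scale inner_sum_right)
    also have "\<dots> = (\<Sum>j\<in>I. if j = i then (v \<bullet> f i) * (f i \<bullet> X (f i)) else 0)"
      using off i by (intro sum.cong) auto
    finally show ?thesis using f(2) i by simp
  qed
  then show ?thesis
    by (simp add: orthonormal_inner_expansion[OF f v, of "X v"] power2_eq_square mult.assoc)
qed

text \<open>
  Since \<open>X\<close> is negative on the span of \<open>f\<close> and positive on that of \<open>g\<close>, the two spans meet
  only in \<open>0\<close> and hence exhaust \<open>span B\<close>. For \<open>u = v + w\<close> with \<open>v\<close>, \<open>w\<close> in the two spans,
  the bound comes from testing \<open>X u\<close> against \<open>w - v\<close>.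
\<close>

lemma symmetric_bounded_below:
  fixes X :: "'a::real_inner \<Rightarrow> 'a"
  assumes f: "orthonormal_on f I" "finite I" and g: "orthonormal_on g K" "finite K"
    and X: "linear X" and sym: "\<And>u v. u \<bullet> X v = X u \<bullet> v"
    and B: "finite B" "f ` I \<subseteq> span B" "g ` K \<subseteq> span B" "card B \<le> card I + card K"
    and offf: "\<And>i j. i \<in> I \<Longrightarrow> j \<in> I \<Longrightarrow> i \<noteq> j \<Longrightarrow> f i \<bullet> X (f j) = 0"
    and offg: "\<And>i j. i \<in> K \<Longrightarrow> j \<in> K \<Longrightarrow> i \<noteq> j \<Longrightarrow> g i \<bullet> X (g j) = 0"
    and neg: "\<And>i. i \<in> I \<Longrightarrow> f i \<bullet> X (f i) \<le> - r"
    and pos: "\<And>i. i \<in> K \<Longrightarrow> r \<le> g i \<bullet> X (g i)" and r: "r > 0"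
    and u: "u \<in> span B"
  shows "r * norm u \<le> norm (X u)"
proof -
  interpret X: linear X by (rule X)
  have negv: "v \<bullet> X v \<le> - r * (v \<bullet> v)" if "v \<in> span (f ` I)" for v
  proof -
    have "v \<bullet> X v = (\<Sum>i\<in>I. (v \<bullet> f i)\<^sup>2 * (f i \<bullet> X (f i)))"
      by (rule quadratic_form_diagonal[OF f X offf that])
    also have "\<dots> \<le> (\<Sum>i\<in>I. (v \<bullet> f i)\<^sup>2 * (- r))"
      by (intro sum_mono mult_left_mono neg) auto
    also have "\<dots> = - r * (\<Sum>i\<in>I. (v \<bullet> f i) * (f i \<bullet> v))"
      by (simp add: sum_distrib_left power2_eq_square inner_commute mult.commute sum_negf mult.assoc)
    finally show ?thesis by (simp only: orthonormal_inner_expansion[OF f that, of v])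
  qed
  have posv: "r * (v \<bullet> v) \<le> v \<bullet> X v" if "v \<in> span (g ` K)" for v
  proof -
    have "r * (v \<bullet> v) = r * (\<Sum>i\<in>K. (v \<bullet> g i) * (g i \<bullet> v))"
      by (simp only: orthonormal_inner_expansion[OF g that, of v])
    also have "\<dots> = (\<Sum>i\<in>K. (v \<bullet> g i)\<^sup>2 * r)"
      by (simp add: sum_distrib_left power2_eq_square inner_commute mult.commute mult.assoc)
    also have "\<dots> \<le> (\<Sum>i\<in>K. (v \<bullet> g i)\<^sup>2 * (g i \<bullet> X (g i)))"
      by (intro sum_mono mult_left_mono pos) auto
    also have "\<dots> = v \<bullet> X v"
      by (rule quadratic_form_diagonal[OF g X offg that, symmetric])
    finally show ?thesis .
  qed
  have zero: "v = 0" if "v \<in> span (f ` I)" "v \<in> span (g ` K)" for v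
  proof -
    have "r * (v \<bullet> v) \<le> - r * (v \<bullet> v)" using negv[OF that(1)] posv[OF that(2)] by linarith
    then have "r * (v \<bullet> v) \<le> 0" by linarith
    then have "v \<bullet> v \<le> 0" using r by (simp add: mult_le_0_iff)
    then show ?thesis by (metis inner_eq_zero_iff inner_ge_zero order_antisym)
  qed
  have fi: "independent (f ` I)" and gi: "independent (g ` K)"
    by (rule orthonormal_independent f g)+
  have disj: "f ` I \<inter> g ` K = {}"
  proof (rule ccontr)
    assume "f ` I \<inter> g ` K \<noteq> {}"
    then obtain v where v: "v \<in> f ` I" "v \<in> g ` K" by blast
    then have "v = 0" by (intro zero) (auto intro: span_base)
    then show False using v(1) fi dependent_zero by blast
  qed
  have ind: "independent (f ` I \<union> g ` K)"
  proof (rule independent_if_scalars_zero)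
    fix s x assume s: "(\<Sum>x\<in>f ` I \<union> g ` K. s x *\<^sub>R x) = 0" and x: "x \<in> f ` I \<union> g ` K"
    have sum0: "(\<Sum>x\<in>f ` I. s x *\<^sub>R x) + (\<Sum>x\<in>g ` K. s x *\<^sub>R x) = 0"
      using s by (subst (asm) sum.union_disjoint) (use f g disj in auto)
    have vf: "(\<Sum>x\<in>f ` I. s x *\<^sub>R x) \<in> span (f ` I)"
      by (intro span_sum span_scale span_base)
    have vg: "(\<Sum>x\<in>g ` K. s x *\<^sub>R x) \<in> span (g ` K)"
      by (intro span_sum span_scale span_base)
    have "(\<Sum>x\<in>f ` I. s x *\<^sub>R x) = - (\<Sum>x\<in>g ` K. s x *\<^sub>R x)"
      using sum0 by (simp add: eq_neg_iff_add_eq_0)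
    then have "(\<Sum>x\<in>f ` I. s x *\<^sub>R x) = 0"
      using zero[OF vf] span_neg[OF vg] by simp
    then have "(\<Sum>x\<in>f ` I. s x *\<^sub>R x) = 0" "(\<Sum>x\<in>g ` K. s x *\<^sub>R x) = 0"
      using sum0 by auto
    then show "s x = 0"
      using x fi gi f(2) g(2) dependent_finite[of "f ` I"] dependent_finite[of "g ` K"] by blast
  qed (use f g in auto)
  have "card (f ` I \<union> g ` K) = card I + card K"
    using card_image[OF orthonormal_inj[OF f(1)]] card_image[OF orthonormal_inj[OF g(1)]]
      card_Un_disjoint[OF _ _ disj] f(2) g(2) by simp
  then have "span (f ` I \<union> g ` K) = span B"
    using B by (intro span_eq_if_card_ge ind) auto
  with u have "u \<in> {x + y |x y. x \<in> span (f ` I) \<and> y \<in> span (g ` K)}"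
    by (simp only: span_Un)
  then obtain v w where vw: "v \<in> span (f ` I)" "w \<in> span (g ` K)" "u = v + w"
    by blast
  have "r * (v \<bullet> v + w \<bullet> w) \<le> w \<bullet> X w - v \<bullet> X v"
    using negv[OF vw(1)] posv[OF vw(2)] by (simp add: algebra_simps)
  \<comment> \<open>The cross terms \<open>v \<bullet> X w\<close> and
    \<open>w \<bullet> X v\<close> cancel by symmetry.\<close>
  also have "\<dots> = X u \<bullet> (w - v)"
    using sym[of v w] inner_commute[of w "X v"] inner_commute[of w "X w"] inner_commute[of v "X v"]
      inner_commute[of v "X w"]
    unfolding vw(3) X.add inner_add_left inner_diff_right by linarith
  also have "\<dots> \<le> norm (X u) * norm (w - v)" by (rule norm_cauchy_schwarz)
  finally have 1: "r * (v \<bullet> v + w \<bullet> w) \<le> norm (X u) * norm (w - v)" .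
  \<comment> \<open>The parallelogram law and the inequality of arithmetic and geometric means bound
    \<open>norm u * norm (w - v)\<close> by \<open>v \<bullet> v + w \<bullet> w\<close>, after
    which the factor \<open>norm (w - v)\<close> can be cancelled.\<close>
  have "(norm u)\<^sup>2 + (norm (w - v))\<^sup>2 = 2 * (v \<bullet> v + w \<bullet> w)"
    using inner_commute[of v w]
    unfolding vw(3) power2_norm_eq_inner inner_add_left inner_add_right inner_diff_left inner_diff_right
    by simp
  moreover have "2 * (norm u * norm (w - v)) \<le> (norm u)\<^sup>2 + (norm (w - v))\<^sup>2"
    using sum_squares_bound[of "norm u" "norm (w - v)"] by simp
  ultimately have "norm u * norm (w - v) \<le> v \<bullet> v + w \<bullet> w" by simp
  then have "r * (norm u * norm (w - v)) \<le> r * (v \<bullet> v + w \<bullet> w)"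
    using r by (intro mult_left_mono) auto
  then have 2: "(r * norm u) * norm (w - v) \<le> norm (X u) * norm (w - v)"
    using 1 unfolding mult.assoc by (rule order_trans)
  show ?thesis
  proof (cases "w = v")
    case True
    then have "v = 0" using zero vw by blast
    then show ?thesis using True vw(3) by simp
  next
    case False
    then show ?thesis using 2 by (simp add: mult_le_cancel_right)
  qed
qed

section \<open>Coordinates of square-summable sequences and Jacobi operators\<close>

lift_definition bas :: "int \<Rightarrow> ell2" is "\<lambda>i n. of_bool (n = i)"
  subgoal for i
    by (rule finite_nonzero_values_imp_summable_on) (rule finite_subset[of _ "{i}"], auto)
  done

lemma inner_bas: "u \<bullet> bas i = Re (ell2_nth u i)"
proof -
  have "(\<Sum>\<^sub>\<infinity>n. ell2_nth u n * cnj (ell2_nth (bas i) n))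
      = (\<Sum>\<^sub>\<infinity>n\<in>{i}. ell2_nth u n * cnj (ell2_nth (bas i) n))"
    by (rule infsum_cong_neutral) (auto simp: bas.rep_eq)
  then show ?thesis by (simp add: inner_ell2_def bas.rep_eq)
qed

lemma bas_inner_bas: "bas i \<bullet> bas j = of_bool (i = j)"
  by (auto simp: inner_bas bas.rep_eq)

lemma orthonormal_bas: "orthonormal_on bas I"
  by (simp add: orthonormal_on_def bas_inner_bas)

text \<open>The finite-dimensional arguments run over real scalars, where \<open>bas\<close> reaches
  only real sequences; a complex vector is handled through its real and imaginary parts.\<close>

lift_definition re_ell2 :: "ell2 \<Rightarrow> ell2" is "\<lambda>u n. complex_of_real (Re (u n))"
  subgoal for u
    by (rule summable_on_comparison_test[of "\<lambda>n. (norm (u n))\<^sup>2"])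
       (auto simp: cmod_power2)
  done

lift_definition im_ell2 :: "ell2 \<Rightarrow> ell2" is "\<lambda>u n. complex_of_real (Im (u n))"
  subgoal for u
    by (rule summable_on_comparison_test[of "\<lambda>n. (norm (u n))\<^sup>2"])
       (auto simp: cmod_power2)
  done

lemma norm_sq_re_im: "(norm u)\<^sup>2 = (norm (re_ell2 u))\<^sup>2 + (norm (im_ell2 u))\<^sup>2"
proof -
  have "(norm u)\<^sup>2 = (\<Sum>\<^sub>\<infinity>n. (norm (ell2_nth (re_ell2 u) n))\<^sup>2 + (norm (ell2_nth (im_ell2 u) n))\<^sup>2)"
    unfolding norm_ell2_sq by (simp add: re_ell2.rep_eq im_ell2.rep_eq cmod_power2)
  then show ?thesis unfolding norm_ell2_sq by (simp add: infsum_add ell2_summable)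
qed

lemma norm_scaleC_ell2: "norm (z *\<^sub>C u) = cmod z * norm (u :: ell2)"
proof -
  have "(norm (z *\<^sub>C u))\<^sup>2 = (cmod z * norm u)\<^sup>2"
    unfolding norm_ell2_sq power_mult_distrib
    by (simp add: norm_mult power_mult_distrib infsum_cmult_right')
  then show ?thesis by simp
qed

lemma real_ell2_approx:
  assumes "e > 0"
  obtains F where "finite F" "norm (re_ell2 u - (\<Sum>i\<in>F. (re_ell2 u \<bullet> bas i) *\<^sub>R bas i)) < e"
proof -
  let ?v = "re_ell2 u"
  have sq: "(norm (ell2_nth ?v n))\<^sup>2 = (?v \<bullet> bas n)\<^sup>2" for n
    by (simp add: inner_bas re_ell2.rep_eq)
  have "((\<lambda>n. (?v \<bullet> bas n)\<^sup>2) has_sum (norm ?v)\<^sup>2) UNIV"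
    using has_sum_infsum[OF ell2_summable[of ?v]] by (simp add: norm_ell2_sq sq)
  then have "\<forall>\<^sub>F F in finite_subsets_at_top UNIV. dist (\<Sum>n\<in>F. (?v \<bullet> bas n)\<^sup>2) ((norm ?v)\<^sup>2) < e\<^sup>2"
    unfolding has_sum_def by (rule tendstoD) (use assms in simp)
  then obtain F where F: "finite F" "dist (\<Sum>n\<in>F. (?v \<bullet> bas n)\<^sup>2) ((norm ?v)\<^sup>2) < e\<^sup>2"
    unfolding eventually_finite_subsets_at_top by blast
  define w where "w = (\<Sum>i\<in>F. (?v \<bullet> bas i) *\<^sub>R bas i)"
  have wv: "w \<bullet> ?v = (\<Sum>n\<in>F. (?v \<bullet> bas n)\<^sup>2)"
    by (simp add: w_def inner_sum_left power2_eq_square inner_commute[of "bas _"])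
  have "w \<bullet> bas i = ?v \<bullet> bas i" if "i \<in> F" for i
    unfolding w_def by (rule orthonormal_sum_inner[OF orthonormal_bas F(1) that])
  then have ww: "w \<bullet> w = (\<Sum>n\<in>F. (?v \<bullet> bas n)\<^sup>2)"
    by (subst (2) w_def) (simp add: inner_sum_right power2_eq_square)
  have "(norm (?v - w))\<^sup>2 = (norm ?v)\<^sup>2 - (\<Sum>n\<in>F. (?v \<bullet> bas n)\<^sup>2)"
    using wv ww by (simp add: power2_norm_eq_inner inner_diff_left inner_diff_right inner_commute)
  also have "\<dots> < e\<^sup>2" using F(2) by (simp add: dist_real_def abs_if split: if_splits)
  finally have "norm (?v - w) < e" using assms by (simp add: power_less_imp_less_base)
  then show ?thesis using that F(1) w_def by blast
qed

section \<open>Shifts and Jacobi operators with constant off-diagonals\<close>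

lift_definition shift :: "int \<Rightarrow> ell2 \<Rightarrow> ell2" is "\<lambda>k u n. u (n + k)"
  by (rule sq_summable_shift)

lemma norm_shift: "norm (shift k u) = norm u"
  unfolding norm_ell2_def by (simp add: shift.rep_eq sq_infsum_shift)

lemma cinner_shift: "cinner (shift k u) v = cinner u (shift (- k) v)"
  unfolding cinner_ell2_def
  using infsum_reindex_bij_betw[of "\<lambda>n. n + k" UNIV UNIV "\<lambda>n. ell2_nth u n * cnj (ell2_nth v (n - k))"]
  by (simp add: shift.rep_eq bij_betw_def)

lemma periodic_const: "periodic p (\<lambda>_. x)"
  by (simp add: periodic_def)

lemma cinner_add_right: "cinner u (v + w) = cinner u v + cinner (u :: 'a::complex_hilbert) w"
  by (metis cinner_add_left cinner_commute complex_cnj_add)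

lemma cinner_scaleC_right: "cinner u (z *\<^sub>C v) = cnj z * cinner (u :: 'a::complex_hilbert) v"
  by (metis cinner_commute cinner_scaleC_left complex_cnj_mult)

abbreviation (input) sym_jacobi :: "(int \<Rightarrow> real) \<Rightarrow> real \<Rightarrow> ell2 \<Rightarrow> ell2"
  where "sym_jacobi a t \<equiv> jacobi a (\<lambda>_. t) (\<lambda>_. t)"

context
  fixes p :: nat and a :: "int \<Rightarrow> real"
  assumes a: "periodic p a" and p: "p \<ge> 1"
begin

lemmas nth_jacobi = ell2_nth_jacobi[OF a periodic_const periodic_const p]

text \<open>A shift is adjoint to its inverse and \<open>sym_jacobi a 0\<close> is a real diagonal,
  so this decomposition shows that taking the adjoint exchanges \<beta> and \<gamma>.\<close>

lemma jacobi_const_eq: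
  "jacobi a (\<lambda>_. \<beta>) (\<lambda>_. \<gamma>) u =
    complex_of_real \<gamma> *\<^sub>C shift (- 1) u + sym_jacobi a 0 u + complex_of_real \<beta> *\<^sub>C shift 1 u"
  by (rule ell2_eqI) (simp add: nth_jacobi shift.rep_eq)

lemma cinner_jacobi:
  "cinner (jacobi a (\<lambda>_. \<beta>) (\<lambda>_. \<gamma>) u) v = cinner u (jacobi a (\<lambda>_. \<gamma>) (\<lambda>_. \<beta>) v)"
proof -
  have "cinner (sym_jacobi a 0 u) v = cinner u (sym_jacobi a 0 v)"
    unfolding cinner_ell2_def by (simp add: nth_jacobi mult_ac)
  then show ?thesis
    unfolding jacobi_const_eq[of \<beta> \<gamma>] jacobi_const_eq[of \<gamma> \<beta>]
    by (simp add: cinner_add_left cinner_add_right cinner_scaleC_left cinner_scaleC_right cinner_shift)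
qed

lemma inner_jacobi: "u \<bullet> sym_jacobi a t v = sym_jacobi a t u \<bullet> v"
  by (simp add: inner_eq_Re_cinner cinner_jacobi)

lemma bounded_clinear_jacobi_const: "bounded_clinear (jacobi a (\<lambda>_. \<beta>) (\<lambda>_. \<gamma>))"
  by (rule bounded_clinear_jacobi[OF a periodic_const periodic_const p])

lemma bounded_linear_jacobi_const: "bounded_linear (jacobi a (\<lambda>_. \<beta>) (\<lambda>_. \<gamma>))"
  using bounded_clinear_jacobi_const by (simp add: bounded_clinear_def)

lemma jacobi_bas:
  "sym_jacobi a t (bas j) = a j *\<^sub>R bas j + t *\<^sub>R bas (j - 1) + t *\<^sub>R bas (j + 1)"
  by (rule ell2_eqI) (auto simp: nth_jacobi bas.rep_eq)

lemma jacobi_bas_matrix: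
  "bas i \<bullet> sym_jacobi a t (bas j) =
    a j * of_bool (i = j) + t * of_bool (i = j - 1) + t * of_bool (i = j + 1)"
  by (simp add: jacobi_bas inner_add_right bas_inner_bas)

text \<open>The difference is the skew part, \<open>(\<beta> - \<gamma>) / 2\<close> times the shift
  minus its inverse; both are isometries.\<close>

lemma norm_jacobi_diff:
  "norm (jacobi a (\<lambda>_. \<beta>) (\<lambda>_. \<gamma>) u - sym_jacobi a ((\<beta> + \<gamma>) / 2) u) \<le> \<bar>\<beta> - \<gamma>\<bar> * norm u"
proof -
  let ?s = "(\<beta> - \<gamma>) / 2"
  have "jacobi a (\<lambda>_. \<beta>) (\<lambda>_. \<gamma>) u - sym_jacobi a ((\<beta> + \<gamma>) / 2) u
      = ?s *\<^sub>R (shift 1 u - shift (- 1) u)"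
    by (rule ell2_eqI) (simp add: nth_jacobi shift.rep_eq field_simps)
  moreover have "norm (shift 1 u - shift (- 1) u) \<le> 2 * norm u"
    using norm_triangle_ineq4[of "shift 1 u" "shift (- 1) u"] by (simp add: norm_shift)
  then have "\<bar>?s\<bar> * norm (shift 1 u - shift (- 1) u) \<le> \<bar>?s\<bar> * (2 * norm u)"
    by (rule mult_left_mono) simp
  ultimately show ?thesis by simp
qed

text \<open>Finitely supported real vectors are dense among real sequences, and the bound passes to
  limits by continuity. Since the matrix entries are real, real and imaginary parts are mapped
  separately and the squared estimates add up.\<close>

lemma jacobi_lower_bound_from_finite:
  assumes fin: "\<And>F u. finite F \<Longrightarrow> u \<in> span (bas ` F) \<Longrightarrow>
      r * norm u \<le> norm (sym_jacobi a t u - x *\<^sub>R u)"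
    and r: "r \<ge> 0"
  shows "r * norm u \<le> norm (sym_jacobi a t u - x *\<^sub>R u)"
proof -
  define X where "X u = sym_jacobi a t u - x *\<^sub>R u" for u
  have X: "bounded_linear X"
    unfolding X_def by (intro bounded_linear_sub bounded_linear_jacobi_const bounded_linear_scaleR_right)
  interpret X: bounded_linear X by (rule X)
  obtain K where K: "K > 0" "\<And>u. norm (X u) \<le> norm u * K" using X.pos_bounded by blast
  have real: "r * norm (re_ell2 u) \<le> norm (X (re_ell2 u))" for u
  proof (rule field_le_epsilon)
    fix e :: real assume e: "e > 0"
    \<comment> \<open>An error of \<open>d\<close> in the vector costs at most \<open>r * d\<close>
      on the left and \<open>K * d\<close> on the right, \<open>e\<close> in total.\<close>
    define d where "d = e / (r + K)"
    have d: "d > 0" "d * (r + K) = e" using e r K(1) by (auto simp: d_def)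
    obtain F where F: "finite F" "norm (re_ell2 u - (\<Sum>i\<in>F. (re_ell2 u \<bullet> bas i) *\<^sub>R bas i)) < d"
      using real_ell2_approx[OF d(1)] by blast
    define w where "w = (\<Sum>i\<in>F. (re_ell2 u \<bullet> bas i) *\<^sub>R bas i)"
    have nd: "norm (re_ell2 u - w) < d" using F(2) by (simp add: w_def)
    have "w \<in> span (bas ` F)" unfolding w_def by (intro span_sum span_scale span_base) auto
    from fin[OF F(1) this] have w: "r * norm w \<le> norm (X w)" by (simp add: X_def)
    have "norm (re_ell2 u) \<le> norm w + d"
      using norm_triangle_sub[of "re_ell2 u" w] nd by simp
    then have "r * norm (re_ell2 u) \<le> r * (norm w + d)" using r by (rule mult_left_mono)
    also have "\<dots> \<le> norm (X w) + r * d" using w by (simp add: distrib_left)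
    also have "norm (X w) \<le> norm (X (re_ell2 u)) + norm (X (re_ell2 u - w))"
      using norm_triangle_ineq4[of "X (re_ell2 u)" "X (re_ell2 u - w)"] by (simp add: X.diff)
    also have "norm (X (re_ell2 u - w)) \<le> d * K"
      using K(2)[of "re_ell2 u - w"] mult_right_mono[OF less_imp_le[OF nd] less_imp_le[OF K(1)]]
      by linarith
    finally show "r * norm (re_ell2 u) \<le> norm (X (re_ell2 u)) + e"
      using d(2) by (simp add: algebra_simps)
  qed
  have rX: "re_ell2 (X u) = X (re_ell2 u)" for u
    by (rule ell2_eqI) (simp add: X_def nth_jacobi re_ell2.rep_eq)
  \<comment> \<open>The imaginary part of \<open>u\<close> is the real part of
    \<open>- (\<i> *\<^sub>C u)\<close>, so the real case covers it too.\<close>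
  have iX: "im_ell2 (X u) = X (re_ell2 (- (\<i> *\<^sub>C u)))" for u
    by (rule ell2_eqI) (simp add: X_def nth_jacobi re_ell2.rep_eq im_ell2.rep_eq)
  have im: "re_ell2 (- (\<i> *\<^sub>C u)) = im_ell2 u" for u
    by (rule ell2_eqI) (simp add: re_ell2.rep_eq im_ell2.rep_eq)
  have "(r * norm u)\<^sup>2 = (r * norm (re_ell2 u))\<^sup>2 + (r * norm (im_ell2 u))\<^sup>2"
    by (simp add: power_mult_distrib norm_sq_re_im[of u] distrib_left)
  also have "\<dots> \<le> (norm (X (re_ell2 u)))\<^sup>2 + (norm (X (im_ell2 u)))\<^sup>2"
    using real[of u] real[of "- (\<i> *\<^sub>C u)"] r by (intro add_mono power_mono) (auto simp: im)
  also have "\<dots> = (norm (X u))\<^sup>2"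
    by (simp add: norm_sq_re_im[of "X u"] rX iX im)
  finally have "r * norm u \<le> norm (X u)" by (rule power2_le_imp_le) simp
  then show ?thesis by (simp add: X_def)
qed

end

section \<open>Invertibility and pseudospectra\<close>

text \<open>
  \<open>A \<circ> B\<close> is coercive because \<open>B\<close> is the adjoint of \<open>A\<close>, so \<open>A (B w) = y\<close> is solved by the
  fixed point of the contraction \<open>w \<mapsto> w - s (A (B w) - y)\<close> for small \<open>s > 0\<close>.
\<close>

lemma surj_if_adjoint_bounded_below:
  fixes A B :: "'h::complex_hilbert \<Rightarrow> 'h"
  assumes A: "bounded_linear A" and B: "bounded_linear B"
    and adj: "\<And>u v. A u \<bullet> v = u \<bullet> B v" and \<kappa>: "\<kappa> > 0"
    and lower: "\<And>u. \<kappa> * norm u \<le> norm (B u)"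
  shows "surj A"
proof -
  interpret A: bounded_linear A by (rule A)
  interpret B: bounded_linear B by (rule B)
  obtain K0 where K0: "K0 > 0" "\<And>u. norm (A u) \<le> norm u * K0" using A.pos_bounded by blast
  \<comment> \<open>The maximum ensures \<open>\<kappa> \<le> K\<close>, which keeps
    \<open>1 - \<kappa>\<^sup>2 / K\<^sup>2\<close> nonnegative under the root.\<close>
  define K where "K = max K0 \<kappa>"
  have K: "K > 0" "\<kappa> \<le> K" "norm (A u) \<le> norm u * K" for u
    using K0 K0(2)[of u] mult_left_mono[of K0 K "norm u"] by (auto simp: K_def intro: order_trans)
  \<comment> \<open>This \<open>s\<close> minimizes \<open>s\<^sup>2 * K\<^sup>2 - 2 * s\<close>,
    the factor of \<open>(norm (B w))\<^sup>2\<close> in the estimate below.\<close>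
  define s where "s = 1 / K\<^sup>2"
  define c where "c = sqrt (1 - \<kappa>\<^sup>2 / K\<^sup>2)"
  have q: "\<kappa>\<^sup>2 / K\<^sup>2 \<le> 1" "\<kappa>\<^sup>2 / K\<^sup>2 > 0"
    using K(1,2) \<kappa> by (auto simp: power_mono)
  then have c: "0 \<le> c" "c < 1" "c\<^sup>2 = 1 - \<kappa>\<^sup>2 / K\<^sup>2" by (auto simp: c_def)
  have contr: "norm (w - s *\<^sub>R A (B w)) \<le> c * norm w" for w
  proof -
    have "(norm (w - s *\<^sub>R A (B w)))\<^sup>2 = (norm w)\<^sup>2 - 2 * s * (A (B w) \<bullet> w) + s\<^sup>2 * (norm (A (B w)))\<^sup>2"
      unfolding power2_norm_eq_inner
      by (simp add: inner_diff_left inner_diff_right inner_commute[of w "A (B w)"] power2_eq_square[of s]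
          algebra_simps)
    moreover have "A (B w) \<bullet> w = (norm (B w))\<^sup>2"
      unfolding power2_norm_eq_inner by (rule adj)
    moreover have "s\<^sup>2 * (norm (A (B w)))\<^sup>2 \<le> s\<^sup>2 * (norm (B w) * K)\<^sup>2"
      using K(3)[of "B w"] by (intro mult_left_mono power_mono) auto
    moreover have "s\<^sup>2 * (norm (B w) * K)\<^sup>2 = s * (norm (B w))\<^sup>2"
      using K(1) by (simp add: s_def power2_eq_square)
    ultimately have "(norm (w - s *\<^sub>R A (B w)))\<^sup>2 \<le> (norm w)\<^sup>2 - s * (norm (B w))\<^sup>2"
      by simp
    also have "\<dots> \<le> (norm w)\<^sup>2 - s * (\<kappa> * norm w)\<^sup>2"
      using lower[of w] \<kappa> by (intro diff_left_mono mult_left_mono power_mono) (auto simp: s_def)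
    also have "\<dots> = (c * norm w)\<^sup>2"
      by (simp add: power_mult_distrib c(3) s_def algebra_simps)
    finally show ?thesis by (rule power2_le_imp_le) (use c in simp)
  qed
  have "\<exists>w. A (B w) = y" for y
  proof -
    have "\<exists>!w. w - s *\<^sub>R (A (B w) - y) = w"
    proof (rule banach_fix_type[OF c(1,2)], intro allI)
      fix v w
      have eq: "(v - s *\<^sub>R (A (B v) - y)) - (w - s *\<^sub>R (A (B w) - y)) = (v - w) - s *\<^sub>R A (B (v - w))"
        by (simp add: A.diff B.diff scaleR_diff_right)
      show "dist (v - s *\<^sub>R (A (B v) - y)) (w - s *\<^sub>R (A (B w) - y)) \<le> c * dist v w"
        unfolding dist_norm eq by (rule contr)
    qed
    then obtain w where "w - s *\<^sub>R (A (B w) - y) = w" by blast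
    then have "s *\<^sub>R (A (B w) - y) = 0" by simp
    then show ?thesis using K(1) by (intro exI[of _ w]) (simp add: s_def)
  qed
  then show ?thesis by (metis surjI surj_def)
qed

text \<open>A lower bound \<kappa> for \<open>z - A\<close> bounds its inverse by
  \<open>1 / \<kappa>\<close>, too little for the pseudospectrum. For non-normal operators a lower
  bound does not in general yield surjectivity, which is therefore a separate assumption.\<close>

lemma not_in_pseudospectrum:
  fixes A :: "'h::complex_hilbert \<Rightarrow> 'h"
  assumes lin: "bounded_linear (\<lambda>u. z *\<^sub>C u - A u)" and clin: "\<And>w u. A (w *\<^sub>C u) = w *\<^sub>C A u"
    and surj: "surj (\<lambda>u. z *\<^sub>C u - A u)"
    and lower: "\<And>u. \<kappa> * norm u \<le> norm (z *\<^sub>C u - A u)" and \<kappa>: "\<epsilon> < \<kappa>" "\<epsilon> \<ge> 0"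
  shows "z \<notin> pseudospectrum \<epsilon> A"
proof -
  define T where "T = (\<lambda>u. z *\<^sub>C u - A u)"
  interpret T: bounded_linear T unfolding T_def by (rule lin)
  have low: "\<kappa> * norm u \<le> norm (T u)" for u unfolding T_def by (rule lower)
  have k0: "\<kappa> > 0" using \<kappa> by simp
  have inj: "inj (T)"
  proof (rule injI)
    fix u v assume "T u = T v"
    then have "\<kappa> * norm (u - v) \<le> 0" using low[of "u - v"] by (simp add: T.diff)
    then show "u = v" using k0 by (simp add: mult_le_0_iff)
  qed
  define R where "R = inv (T)"
  have TR: "T (R x) = x" and RT: "R (T x) = x" for x
    using surj[folded T_def] inj by (auto simp: R_def surj_f_inv_f)
  have Rn: "norm (R x) \<le> 1 / \<kappa> * norm x" for x
    using low[of "R x"] k0 by (simp add: TR field_simps)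
  have T_scaleC: "T (w *\<^sub>C u) = w *\<^sub>C T u" for w u
  proof -
    have "w *\<^sub>C (z *\<^sub>C u - A u) + w *\<^sub>C A u = w *\<^sub>C (z *\<^sub>C u)"
      by (simp flip: scaleC_add_right)
    then have "w *\<^sub>C (z *\<^sub>C u - A u) = w *\<^sub>C (z *\<^sub>C u) - w *\<^sub>C A u"
      by (simp only: eq_diff_eq)
    then show ?thesis by (simp add: T_def clin scaleC_scaleC mult.commute)
  qed
  have "bounded_linear R"
  proof (rule bounded_linear_intro)
    show "R (x + y) = R x + R y" for x y using RT[of "R x + R y"] by (simp add: T.add TR)
    show "R (r *\<^sub>R x) = r *\<^sub>R R x" for r x using RT[of "r *\<^sub>R R x"] by (simp add: T.scaleR TR)
    show "norm (R x) \<le> norm x * (1 / \<kappa>)" for x using Rn[of x] by simp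
  qed
  moreover have "R (w *\<^sub>C x) = w *\<^sub>C R x" for w x
    using RT[of "w *\<^sub>C R x"] by (simp add: T_scaleC TR)
  ultimately have "bounded_clinear R" by (simp add: bounded_clinear_def)
  then have "z \<notin> spectrum A"
    using TR RT by (auto simp: spectrum_def T_def)
  moreover have "resolvent A z = R"
    using TR RT by (intro resolvent_unique) (auto simp: T_def)
  moreover have "onorm R \<le> 1 / \<kappa>" by (rule onorm_bound) (use Rn k0 in auto)
  moreover have "1 / \<kappa> < 1 / \<epsilon>" if "\<epsilon> > 0" using \<kappa> that by (simp add: frac_less2)
  ultimately show ?thesis by (auto simp: pseudospectrum_def)
qed

text \<open>Outside the spectrum the resolvent maps a vector of norm at most
  \<open>\<delta> + e\<close> to a unit vector, so in the limit its norm is at least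
  \<open>1 / \<delta>\<close>. At \<open>\<delta> = 0\<close> this is impossible and
  \<open>z\<close> lies in the spectrum.\<close>

lemma in_pseudospectrum:
  fixes A :: "'h::complex_hilbert \<Rightarrow> 'h"
  assumes approx: "\<And>e. e > 0 \<Longrightarrow> \<exists>u. norm u = 1 \<and> norm (z *\<^sub>C u - A u) \<le> \<delta> + e"
    and \<delta>: "0 \<le> \<delta>" "\<delta> \<le> \<epsilon>"
  shows "z \<in> pseudospectrum \<epsilon> A"
proof (cases "z \<in> spectrum A")
  case False
  then obtain R where R: "bounded_linear R" and RT: "\<And>x. R (z *\<^sub>C x - A x) = x"
    and TR: "\<And>x. z *\<^sub>C R x - A (R x) = x"
    by (auto simp: spectrum_def bounded_clinear_def)
  have res: "resolvent A z = R" by (rule resolvent_unique) (rule RT TR)+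
  have pos: "onorm R \<ge> 0" by (rule onorm_pos_le[OF R])
  have "1 \<le> onorm R * \<delta>"
  proof (rule field_le_epsilon)
    fix e :: real assume e: "e > 0"
    define d where "d = e / (onorm R + 1)"
    have d: "d > 0" "onorm R * d \<le> e"
      using e pos by (auto simp: d_def field_simps)
    obtain u where u: "norm u = 1" "norm (z *\<^sub>C u - A u) \<le> \<delta> + d" using approx[OF d(1)] by blast
    have "1 = norm (R (z *\<^sub>C u - A u))" by (simp add: RT u)
    also have "\<dots> \<le> onorm R * norm (z *\<^sub>C u - A u)" by (rule onorm[OF R])
    also have "\<dots> \<le> onorm R * (\<delta> + d)" using u(2) pos by (rule mult_left_mono)
    finally show "1 \<le> onorm R * \<delta> + e" using d(2) by (simp add: distrib_left)
  qed
  moreover from this have "\<delta> > 0" using \<delta>(1) by (cases "\<delta> = 0") auto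
  ultimately have "1 / \<delta> \<le> onorm R" by (simp add: field_simps)
  moreover have "1 / \<epsilon> \<le> 1 / \<delta>" using \<open>\<delta> > 0\<close> \<delta>(2) by (simp add: frac_le)
  ultimately show ?thesis using False \<open>\<delta> > 0\<close> \<delta>(2) by (simp add: pseudospectrum_def res)
qed (simp add: pseudospectrum_def)

text \<open>
  For \<open>T = \<lambda> - H \<ge> 0\<close> with \<open>\<lambda>\<close> the supremum of the Rayleigh quotient, evaluating the form of
  \<open>T\<close> at \<open>u - T u / K\<close> bounds \<open>\<parallel>T u\<parallel>\<^sup>2\<close> by \<open>K (u \<bullet> T u)\<close>.
\<close>

lemma rayleigh_sup_approximate_eigenvalue:
  fixes H :: "'a::real_inner \<Rightarrow> 'a"
  assumes H: "bounded_linear H" and sym: "\<And>u v. u \<bullet> H v = H u \<bullet> v"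
    and v: "norm v = 1"
  obtains l where "v \<bullet> H v \<le> l" "\<And>e. e > 0 \<Longrightarrow> \<exists>u. norm u = 1 \<and> norm (l *\<^sub>R u - H u) \<le> e"
proof -
  interpret H: bounded_linear H by (rule H)
  obtain K0 where K0: "K0 > 0" "\<And>u. norm (H u) \<le> norm u * K0" using H.pos_bounded by blast
  let ?S = "{u \<bullet> H u | u. norm u = 1}"
  define l where "l = Sup ?S"
  have le: "u \<bullet> H u \<le> K0" if "norm u = 1" for u
    using norm_cauchy_schwarz[of u "H u"] K0(2)[of u] that by simp
  have bdd: "bdd_above ?S" using le by (auto intro!: bdd_aboveI)
  have up: "u \<bullet> H u \<le> l" if "norm u = 1" for u
    unfolding l_def by (rule cSup_upper[OF _ bdd]) (use that in auto)
  define T where "T u = l *\<^sub>R u - H u" for u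
  have T: "bounded_linear T"
    unfolding T_def by (intro bounded_linear_sub H bounded_linear_scaleR_right)
  interpret T: bounded_linear T by (rule T)
  obtain K where K: "K > 0" "\<And>u. norm (T u) \<le> norm u * K" using T.pos_bounded by blast
  have Tsym: "u \<bullet> T w = T u \<bullet> w" for u w
    by (simp add: T_def inner_diff_left inner_diff_right sym)
  have Tpos: "0 \<le> u \<bullet> T u" for u
  proof (cases "u = 0")
    case False
    have "norm ((1 / norm u) *\<^sub>R u) = 1" using False by simp
    from up[OF this] have "u \<bullet> H u \<le> l * (u \<bullet> u)"
      using False by (simp add: H.scaleR field_simps power2_norm_eq_inner[symmetric] power2_eq_square)
    then show ?thesis by (simp add: T_def inner_diff_right)
  qed simp
  have bound: "(norm (T u))\<^sup>2 \<le> K * (u \<bullet> T u)" for u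
  proof -
    define s where "s = 1 / K"
    have s: "s > 0" "s * K = 1" using K(1) by (auto simp: s_def)
    have "0 \<le> (u - s *\<^sub>R T u) \<bullet> T (u - s *\<^sub>R T u)" by (rule Tpos)
    also have "\<dots> = u \<bullet> T u - 2 * s * (norm (T u))\<^sup>2 + s\<^sup>2 * (T u \<bullet> T (T u))"
      using Tsym[of u "T u"] unfolding power2_norm_eq_inner
      by (simp add: T.diff T.scaleR inner_diff_left inner_diff_right power2_eq_square[of s]
          algebra_simps)
    finally have 1: "0 \<le> u \<bullet> T u - 2 * s * (norm (T u))\<^sup>2 + s\<^sup>2 * (T u \<bullet> T (T u))" .
    have "T u \<bullet> T (T u) \<le> norm (T u) * (norm (T u) * K)"
      using norm_cauchy_schwarz[of "T u" "T (T u)"] mult_left_mono[OF K(2)[of "T u"], of "norm (T u)"]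
      by simp
    then have "s\<^sup>2 * (T u \<bullet> T (T u)) \<le> s\<^sup>2 * (norm (T u) * (norm (T u) * K))"
      by (rule mult_left_mono) simp
    also have "\<dots> = s * (s * K) * (norm (T u))\<^sup>2" by (simp add: power2_eq_square)
    finally have "s * (norm (T u))\<^sup>2 \<le> u \<bullet> T u" using 1 s(2) by simp
    then have "K * (s * (norm (T u))\<^sup>2) \<le> K * (u \<bullet> T u)" using K(1) by (intro mult_left_mono) auto
    then show ?thesis using s(2) K(1) by (simp add: s_def)
  qed
  show ?thesis
  proof
    show "v \<bullet> H v \<le> l" by (rule up[OF v])
    fix e :: real assume e: "e > 0"
    \<comment> \<open>The threshold is such that
      \<open>K * (u \<bullet> T u) \<le> e\<^sup>2\<close>, whence
      \<open>norm (T u) \<le> e\<close>.\<close>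
    then have "l - e\<^sup>2 / K < Sup ?S" using K(1) by (simp add: l_def)
    then obtain u where u: "norm u = 1" "l - e\<^sup>2 / K < u \<bullet> H u"
      using less_cSup_iff[OF _ bdd] v by auto
    have "u \<bullet> T u = l - u \<bullet> H u" using u(1) by (simp add: T_def inner_diff_right norm_eq_1)
    also have "\<dots> \<le> e\<^sup>2 / K" using u(2) by simp
    finally have "K * (u \<bullet> T u) \<le> e\<^sup>2" using K(1) by (simp add: field_simps)
    then have "(norm (T u))\<^sup>2 \<le> e\<^sup>2" using bound[of u] by linarith
    then have "norm (T u) \<le> e" by (rule power2_le_imp_le) (use e in simp)
    then show "\<exists>u. norm u = 1 \<and> norm (l *\<^sub>R u - H u) \<le> e" using u(1) by (auto simp: T_def)
  qed
qed

section \<open>Jacobi operators on a ring\<close>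

lemma sum_periodic_window:
  assumes "periodic p a"
  shows "(\<Sum>i\<in>{n..<n + int p}. a i) = (\<Sum>i\<in>{0..<int p}. a i)"
proof (cases "p = 0")
  case False
  have step: "(\<Sum>i\<in>{k + 1..<k + 1 + int p}. a i) = (\<Sum>i\<in>{k..<k + int p}. a i)" for k
  proof -
    have "{k..<k + int p} = insert k {k + 1..<k + int p}"
      and "{k + 1..<k + 1 + int p} = insert (k + int p) {k + 1..<k + int p}"
      using False by auto
    then show ?thesis using assms by (simp add: periodic_def)
  qed
  show ?thesis
  proof (induction n rule: int_induct[where k = 0])
    case (step2 i)
    then show ?case using step[of "i - 1"] by simp
  qed (use step in simp_all)
qed simp

text \<open>The norm of a linear combination depends only on the Gram matrix; this compares vectors
  on the line with their counterparts on the ring.\<close>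

lemma norm_sum_scaleR_cong:
  fixes f :: "'i \<Rightarrow> 'a::real_inner" and g :: "'i \<Rightarrow> 'b::real_inner"
  assumes "\<And>i j. i \<in> F \<Longrightarrow> j \<in> F \<Longrightarrow> f i \<bullet> f j = g i \<bullet> g j"
  shows "norm (\<Sum>i\<in>F. c i *\<^sub>R f i) = norm (\<Sum>i\<in>F. c i *\<^sub>R g i)"
  by (simp add: norm_eq_sqrt_inner inner_sum_left inner_sum_right assms cong: sum.cong)

text \<open>Closes the line to a cycle of \<open>L\<close> sites by corner entries \<open>t\<close>.
  It acts on the same space as the operator on the line and vanishes on \<open>bas\<close> of all
  other sites, so that both share these vectors.\<close>

definition ring_op :: "(int \<Rightarrow> real) \<Rightarrow> real \<Rightarrow> int \<Rightarrow> ell2 \<Rightarrow> ell2"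
  where "ring_op a t L u = (\<Sum>j\<in>{0..<L}. (u \<bullet> bas j) *\<^sub>R
    (a j *\<^sub>R bas j + t *\<^sub>R bas ((j - 1) mod L) + t *\<^sub>R bas ((j + 1) mod L)))"

lemma linear_ring_op: "linear (ring_op a t L)"
  by (rule linearI)
     (simp_all add: ring_op_def inner_add_left scaleR_add_left sum.distrib scaleR_sum_right)

lemma ring_op_bas:
  assumes "L > 0" "a (j mod L) = a j"
  shows "ring_op a t L (bas (j mod L)) =
    a j *\<^sub>R bas (j mod L) + t *\<^sub>R bas ((j - 1) mod L) + t *\<^sub>R bas ((j + 1) mod L)"
proof -
  have "ring_op a t L (bas (j mod L)) = (\<Sum>i\<in>{0..<L}. if i = j mod L then
      a i *\<^sub>R bas i + t *\<^sub>R bas ((i - 1) mod L) + t *\<^sub>R bas ((i + 1) mod L) else 0)"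
    unfolding ring_op_def by (rule sum.cong) (auto simp: bas_inner_bas)
  then show ?thesis using assms by (simp add: mod_simps)
qed

lemma sum_shift_mod:
  fixes L :: int
  assumes "L > 0"
  shows "(\<Sum>j\<in>{0..<L}. g j ((j + 1) mod L)) = (\<Sum>j\<in>{0..<L}. g ((j - 1) mod L) j)"
  by (rule sum.reindex_bij_witness[of _ "\<lambda>j. (j - 1) mod L" "\<lambda>j. (j + 1) mod L"])
     (use assms in \<open>auto simp: mod_simps\<close>)

lemma inner_ring_op:
  assumes "L > 0"
  shows "u \<bullet> ring_op a t L v = ring_op a t L u \<bullet> v"
proof -
  let ?u = "\<lambda>j. u \<bullet> bas j" and ?v = "\<lambda>j. v \<bullet> bas j"
  have "u \<bullet> ring_op a t L v = (\<Sum>j\<in>{0..<L}. a j * (?u j * ?v j))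
      + t * (\<Sum>j\<in>{0..<L}. ?v j * ?u ((j - 1) mod L)) + t * (\<Sum>j\<in>{0..<L}. ?v j * ?u ((j + 1) mod L))"
    by (simp add: ring_op_def inner_sum_right inner_add_right sum.distrib sum_distrib_left algebra_simps)
  moreover have "ring_op a t L u \<bullet> v = (\<Sum>j\<in>{0..<L}. a j * (?u j * ?v j))
      + t * (\<Sum>j\<in>{0..<L}. ?u j * ?v ((j - 1) mod L)) + t * (\<Sum>j\<in>{0..<L}. ?u j * ?v ((j + 1) mod L))"
    by (simp add: ring_op_def inner_sum_left inner_add_left sum.distrib sum_distrib_left
        inner_commute[of "bas _" v] algebra_simps)
  ultimately show ?thesis
    using sum_shift_mod[OF assms, of "\<lambda>i j. ?v i * ?u j"] sum_shift_mod[OF assms, of "\<lambda>i j. ?u i * ?v j"]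
    by (simp add: mult.commute)
qed

text \<open>The blocks leave out the sites \<open>n + k * p\<close>, so a hop by \<open>d\<close>
  never leads from one block into another. Divisibility by \<open>p\<close> first settles
  \<open>s\<close>, then divisibility by \<open>N\<close> settles \<open>k\<close>.\<close>

lemma block_index_dvd:
  fixes p N k k' s s' d :: int
  assumes "k \<in> {0..<N}" "k' \<in> {0..<N}" "s \<in> {1..<p}" "s' \<in> {1..<p}" "\<bar>d\<bar> \<le> 1"
  shows "(n + k * p + s) mod (N * p) = (n + k' * p + s' + d) mod (N * p) \<longleftrightarrow> k = k' \<and> s = s' + d"
proof
  assume "(n + k * p + s) mod (N * p) = (n + k' * p + s' + d) mod (N * p)"
  then have dvd: "N * p dvd (n + k * p + s) - (n + k' * p + s' + d)" by (simp add: mod_eq_dvd_iff)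
  then have "N * p dvd (k - k') * p + (s - s' - d)" by (simp add: algebra_simps)
  then have "p dvd (k - k') * p + (s - s' - d)" by (rule dvd_mult_right)
  then have "p dvd s - s' - d" by (simp add: dvd_add_right_iff)
  \<comment> \<open>\<open>s\<close> and \<open>s'\<close> differ by at most \<open>p - 2\<close>,
    which leaves room for a hop of one site.\<close>
  moreover have "\<bar>s - s' - d\<bar> < p" using assms by auto
  ultimately have sd: "s - s' - d = 0" using dvd_imp_le_int[of "s - s' - d" p] by linarith
  with dvd have "N * p dvd (k - k') * p" by (simp add: algebra_simps)
  then have "N dvd k - k'" using assms(3) by simp
  moreover have "\<bar>k - k'\<bar> < N" using assms by auto
  ultimately have "k - k' = 0" using dvd_imp_le_int[of "k - k'" N] by linarith
  then show "k = k' \<and> s = s' + d" using sd by simp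
qed (simp add: add.assoc)

text \<open>Transplants a vector supported on the sites \<open>n + 1, ..., n + p - 1\<close> into
  period \<open>k\<close> of the ring. The index \<open>s = 0\<close> is absent because that site is
  deleted.\<close>

definition block_copy :: "nat \<Rightarrow> int \<Rightarrow> int \<Rightarrow> int \<Rightarrow> ell2 \<Rightarrow> ell2"
  where "block_copy p n L k v =
    (\<Sum>s\<in>{1..<int p}. (v \<bullet> bas (n + s)) *\<^sub>R bas ((n + k * int p + s) mod L))"

lemma block_expansion:
  assumes "v \<in> span (bas ` {n + 1..<n + int p})"
  shows "v = (\<Sum>s\<in>{1..<int p}. (v \<bullet> bas (n + s)) *\<^sub>R bas (n + s))"
proof -
  have "v = (\<Sum>i\<in>{n + 1..<n + int p}. (v \<bullet> bas i) *\<^sub>R bas i)"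
    by (rule orthonormal_expansion[OF orthonormal_bas _ assms]) simp
  also have "\<dots> = (\<Sum>s\<in>{1..<int p}. (v \<bullet> bas (n + s)) *\<^sub>R bas (n + s))"
    by (rule sum.reindex_bij_witness[of _ "\<lambda>s. n + s" "\<lambda>i. i - n"]) auto
  finally show ?thesis .
qed

lemma inner_linear_sum:
  fixes X :: "'a::real_inner \<Rightarrow> 'a"
  assumes "linear X"
  shows "(\<Sum>s\<in>S. c s *\<^sub>R f s) \<bullet> X (\<Sum>s\<in>S. d s *\<^sub>R g s) =
    (\<Sum>s\<in>S. \<Sum>s'\<in>S. c s * (d s' * (f s \<bullet> X (g s'))))"
proof -
  interpret X: linear X by (rule assms)
  have "(\<Sum>s\<in>S. c s *\<^sub>R f s) \<bullet> X (\<Sum>s\<in>S. d s *\<^sub>R g s) =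
      (\<Sum>s\<in>S. c s * (f s \<bullet> (\<Sum>s'\<in>S. d s' *\<^sub>R X (g s'))))"
    by (simp only: X.sum X.scale inner_sum_left inner_scaleR_left)
  then show ?thesis by (simp add: inner_sum_right sum_distrib_left)
qed

text \<open>With \<open>X\<close> and \<open>Y\<close> the identity and \<delta> the indicator of
  \<open>k = k'\<close> this gives orthonormality of the copies; with the ring and line operators it
  gives the matrix elements between them.\<close>

lemma block_copy_form:
  assumes v: "v \<in> span (bas ` {n + 1..<n + int p})" and w: "w \<in> span (bas ` {n + 1..<n + int p})"
    and X: "linear X" and Y: "linear Y"
    and entries: "\<And>s s'. s \<in> {1..<int p} \<Longrightarrow> s' \<in> {1..<int p} \<Longrightarrow>
      bas ((n + k * int p + s) mod L) \<bullet> X (bas ((n + k' * int p + s') mod L))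
        = \<delta> * (bas (n + s) \<bullet> Y (bas (n + s')))"
  shows "block_copy p n L k v \<bullet> X (block_copy p n L k' w) = \<delta> * (v \<bullet> Y w)"
proof -
  have "\<delta> * (v \<bullet> Y w) = \<delta> * ((\<Sum>s\<in>{1..<int p}. (v \<bullet> bas (n + s)) *\<^sub>R bas (n + s))
      \<bullet> Y (\<Sum>s\<in>{1..<int p}. (w \<bullet> bas (n + s)) *\<^sub>R bas (n + s)))"
    using block_expansion[OF v] block_expansion[OF w] by simp
  also have "\<dots> = block_copy p n L k v \<bullet> X (block_copy p n L k' w)"
    unfolding block_copy_def inner_linear_sum[OF X] inner_linear_sum[OF Y] sum_distrib_left
    by (intro sum.cong refl) (simp add: entries mult_ac)
  finally show ?thesis by simp
qed

lemma block_copy_in_span: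
  assumes "L > 0"
  shows "block_copy p n L k v \<in> span (bas ` {0..<L})"
  unfolding block_copy_def using assms by (intro span_sum span_scale span_base) auto

section \<open>Block eigenvectors on the ring and the passage back to the line\<close>

context
  fixes p :: nat and a :: "int \<Rightarrow> real" and t :: real
  assumes a: "periodic p a" and p: "p \<ge> 1"
begin

lemma periodic_mod_multiple: "a (j mod (N * int p)) = a j"
  using periodic_mod[OF a, of "j mod (N * int p)"] periodic_mod[OF a, of j] by (simp add: mod_mod_cancel)

lemma linear_jacobi: "linear (sym_jacobi a t)"
  by (rule bounded_linear.linear[OF bounded_linear_jacobi_const[OF a p]])

lemma block_copy_orthonormal:
  assumes e: "orthonormal_on e A" "\<And>l. l \<in> A \<Longrightarrow> e l \<in> span (bas ` {n + 1..<n + int p})"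
  shows "orthonormal_on (\<lambda>(l, k). block_copy p n (N * int p) k (e l)) (A \<times> {0..<N})"
proof -
  have "block_copy p n (N * int p) k (e l) \<bullet> block_copy p n (N * int p) k' (e l') = of_bool (k = k') * (e l \<bullet> e l')"
    if "l \<in> A" "l' \<in> A" "k \<in> {0..<N}" "k' \<in> {0..<N}" for l l' k k'
    by (rule block_copy_form[where X = "\<lambda>x. x" and Y = "\<lambda>x. x"])
       (use that e(2) block_index_dvd[OF that(3,4), of _ _ _ 0] in \<open>auto simp: bas_inner_bas linear_id[unfolded id_def]\<close>)
  then show ?thesis using e(1) by (auto simp: orthonormal_on_def)
qed

text \<open>Distinct copies are separated by deleted sites and do not interact; inside one copy the
  ring operator has the entries of the line operator because \<open>a\<close> is periodic.\<close>

lemma block_copy_ring_op: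
  assumes v: "v \<in> span (bas ` {n + 1..<n + int p})" and w: "w \<in> span (bas ` {n + 1..<n + int p})"
    and k: "k \<in> {0..<N}" "k' \<in> {0..<N}"
  shows "block_copy p n (N * int p) k v \<bullet> ring_op a t (N * int p) (block_copy p n (N * int p) k' w)
    = of_bool (k = k') * (v \<bullet> sym_jacobi a t w)"
proof (rule block_copy_form[OF v w linear_ring_op linear_jacobi])
  fix s s' assume s: "s \<in> {1..<int p}" "s' \<in> {1..<int p}"
  let ?j = "n + k' * int p + s'"
  have L: "N * int p > 0" using k p by auto
  have aj: "a ?j = a (n + s')"
    using periodic_mod[OF a, of ?j] periodic_mod[OF a, of "n + s'"]
    by (metis add.assoc add.commute mod_mult_self1)
  have eq: "(n + k * int p + s) mod (N * int p) = (?j + d) mod (N * int p) \<longleftrightarrow> k = k' \<and> s = s' + d"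
    if "\<bar>d\<bar> \<le> 1" for d
    by (rule block_index_dvd[OF k s that])
  show "bas ((n + k * int p + s) mod (N * int p)) \<bullet> ring_op a t (N * int p) (bas (?j mod (N * int p)))
      = of_bool (k = k') * (bas (n + s) \<bullet> sym_jacobi a t (bas (n + s')))"
    using eq[of 0] eq[of 1] eq[of "- 1"]
    by (simp add: ring_op_bas[where a = a, OF L periodic_mod_multiple] inner_add_right bas_inner_bas
        jacobi_bas_matrix[OF a p] aj)
qed

text \<open>The copies supply \<open>N * card A\<close> directions where the form is at most
  \<open>- r\<close> and \<open>N * card C\<close> where it is at least \<open>r\<close>, together
  no fewer than the \<open>N * p\<close> sites of the ring. The two families come from the cuts
  \<open>n\<close> and \<open>m\<close> and need not be orthogonal to each other.\<close>

lemma ring_op_lower_bound: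
  fixes e g :: "nat \<Rightarrow> ell2"
  assumes e: "orthonormal_on e A" "finite A" "\<And>l. l \<in> A \<Longrightarrow> e l \<in> span (bas ` {n + 1..<n + int p})"
    and g: "orthonormal_on g C" "finite C" "\<And>l. l \<in> C \<Longrightarrow> g l \<in> span (bas ` {m + 1..<m + int p})"
    and eH: "\<And>l l'. l \<in> A \<Longrightarrow> l' \<in> A \<Longrightarrow> l \<noteq> l' \<Longrightarrow> e l \<bullet> sym_jacobi a t (e l') = 0"
    and gH: "\<And>l l'. l \<in> C \<Longrightarrow> l' \<in> C \<Longrightarrow> l \<noteq> l' \<Longrightarrow> g l \<bullet> sym_jacobi a t (g l') = 0"
    and neg: "\<And>l. l \<in> A \<Longrightarrow> e l \<bullet> sym_jacobi a t (e l) \<le> - r" and pos: "\<And>l. l \<in> C \<Longrightarrow> r \<le> g l \<bullet> sym_jacobi a t (g l)"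
    and card: "p \<le> card A + card C" and r: "r > 0" and N: "N > 0"
    and u: "u \<in> span (bas ` {0..<N * int p})"
  shows "r * norm u \<le> norm (ring_op a t (N * int p) u)"
proof -
  have L: "N * int p > 0" using N p by simp
  have "card (bas ` {0..<N * int p}) \<le> nat (N * int p)"
    using card_image_le[of "{0..<N * int p}" bas] by simp
  also have "\<dots> = nat N * p" using N by (simp add: nat_mult_distrib)
  also have "\<dots> \<le> nat N * (card A + card C)" using card by simp
  also have "\<dots> = card (A \<times> {0..<N}) + card (C \<times> {0..<N})"
    by (simp add: card_cartesian_product algebra_simps)
  finally have cd: "card (bas ` {0..<N * int p}) \<le> card (A \<times> {0..<N}) + card (C \<times> {0..<N})" .
  show ?thesis
  proof (rule symmetric_bounded_below[OF block_copy_orthonormal[OF e(1,3)] _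
        block_copy_orthonormal[OF g(1,3)] _ linear_ring_op inner_ring_op[OF L] _ _ _ cd _ _ _ _ r u])
    show "(case i of (l, k) \<Rightarrow> block_copy p n (N * int p) k (e l)) \<bullet>
        ring_op a t (N * int p) (case j of (l, k) \<Rightarrow> block_copy p n (N * int p) k (e l)) = 0"
      if "i \<in> A \<times> {0..<N}" "j \<in> A \<times> {0..<N}" "i \<noteq> j" for i j
      using that e(3) eH[of "fst i" "fst j"]
      by (cases "fst i = fst j") (auto simp: block_copy_ring_op)
    show "(case i of (l, k) \<Rightarrow> block_copy p m (N * int p) k (g l)) \<bullet>
        ring_op a t (N * int p) (case j of (l, k) \<Rightarrow> block_copy p m (N * int p) k (g l)) = 0"
      if "i \<in> C \<times> {0..<N}" "j \<in> C \<times> {0..<N}" "i \<noteq> j" for i j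
      using that g(3) gH[of "fst i" "fst j"]
      by (cases "fst i = fst j") (auto simp: block_copy_ring_op)
    show "(case i of (l, k) \<Rightarrow> block_copy p n (N * int p) k (e l)) \<bullet>
        ring_op a t (N * int p) (case i of (l, k) \<Rightarrow> block_copy p n (N * int p) k (e l)) \<le> - r"
      if "i \<in> A \<times> {0..<N}" for i
      using that e(3) neg by (auto simp: block_copy_ring_op)
    show "r \<le> (case i of (l, k) \<Rightarrow> block_copy p m (N * int p) k (g l)) \<bullet>
        ring_op a t (N * int p) (case i of (l, k) \<Rightarrow> block_copy p m (N * int p) k (g l))"
      if "i \<in> C \<times> {0..<N}" for i
      using that g(3) pos by (auto simp: block_copy_ring_op)
  qed (use e(2) g(2) block_copy_in_span[OF L] in auto)
qed

text \<open>A finitely supported vector does not notice that a sufficiently long line is closed up to a ring.\<close>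

lemma jacobi_lower_bound_from_ring:
  assumes ring: "\<And>N u. N > 0 \<Longrightarrow> u \<in> span (bas ` {0..<N * int p}) \<Longrightarrow>
      r * norm u \<le> norm (ring_op a t (N * int p) u)"
    and F: "finite F" "u \<in> span (bas ` F)"
  shows "r * norm u \<le> norm (sym_jacobi a t u)"
proof -
  obtain M where M: "\<And>i. i \<in> F \<Longrightarrow> \<bar>i\<bar> \<le> M" "M \<ge> 0"
  proof
    show "\<bar>i\<bar> \<le> (\<Sum>j\<in>F. \<bar>j\<bar>)" if "i \<in> F" for i
      using member_le_sum[OF that, of abs] F(1) by simp
  qed (simp add: sum_nonneg)
  \<comment> \<open>Sites of \<open>F\<close> and their neighbours lie within \<open>M + 1\<close>
    of the origin, so two of them differ by at most \<open>2 * M + 2 < N\<close>; reduction modulo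
    the ring length keeps them apart.\<close>
  define N where "N = 2 * M + 3"
  define L where "L = N * int p"
  have N: "N > 0" using M(2) by (simp add: N_def)
  have LN: "L \<ge> N" using N p mult_left_mono[of 1 "int p" N] by (simp add: L_def)
  then have L: "L > 0" using N by simp
  have bas_mod: "bas (i mod L) \<bullet> bas (j mod L) = bas i \<bullet> bas j"
    if "\<bar>i\<bar> \<le> M + 1" "\<bar>j\<bar> \<le> M + 1" for i j
  proof -
    have "i = j" if "i mod L = j mod L"
    proof -
      have "L dvd i - j" using that by (simp add: mod_eq_dvd_iff)
      moreover have "\<bar>i - j\<bar> < L"
        using \<open>\<bar>i\<bar> \<le> M + 1\<close> \<open>\<bar>j\<bar> \<le> M + 1\<close> LN unfolding N_def by linarith
      ultimately show ?thesis using dvd_imp_le_int[of "i - j" L] by linarith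
    qed
    then show ?thesis by (auto simp: bas_inner_bas)
  qed
  define u' where "u' = (\<Sum>i\<in>F. (u \<bullet> bas i) *\<^sub>R bas (i mod L))"
  have u: "u = (\<Sum>i\<in>F. (u \<bullet> bas i) *\<^sub>R bas i)"
    by (rule orthonormal_expansion[OF orthonormal_bas F])
  have F1: "\<bar>i\<bar> \<le> M + 1" "\<bar>i - 1\<bar> \<le> M + 1" "\<bar>i + 1\<bar> \<le> M + 1" if "i \<in> F" for i
    using M(1)[OF that] by auto
  have "norm u' = norm (\<Sum>i\<in>F. (u \<bullet> bas i) *\<^sub>R bas i)"
    unfolding u'_def by (rule norm_sum_scaleR_cong) (use F1 bas_mod in auto)
  also have "\<dots> = norm u" using u by simp
  finally have nu: "norm u' = norm u" .
  have "ring_op a t L u' = (\<Sum>i\<in>F. (u \<bullet> bas i) *\<^sub>R ring_op a t L (bas (i mod L)))"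
    unfolding u'_def by (simp add: linear_sum[OF linear_ring_op] linear_scale[OF linear_ring_op])
  then have "norm (ring_op a t L u') = norm (\<Sum>i\<in>F. (u \<bullet> bas i) *\<^sub>R ring_op a t L (bas (i mod L)))"
    by simp
  also have "\<dots> = norm (\<Sum>i\<in>F. (u \<bullet> bas i) *\<^sub>R sym_jacobi a t (bas i))"
  proof (rule norm_sum_scaleR_cong)
    fix i j assume "i \<in> F" "j \<in> F"
    then show "ring_op a t L (bas (i mod L)) \<bullet> ring_op a t L (bas (j mod L)) = sym_jacobi a t (bas i) \<bullet> sym_jacobi a t (bas j)"
      using periodic_mod_multiple[of _ N]
      by (simp add: ring_op_bas[OF L] L_def[symmetric] jacobi_bas[OF a p] inner_add_left inner_add_right
          bas_mod F1)
  qed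
  also have "(\<Sum>i\<in>F. (u \<bullet> bas i) *\<^sub>R sym_jacobi a t (bas i)) = sym_jacobi a t u"
    by (subst (2) u) (simp add: linear_sum[OF linear_jacobi] linear_scale[OF linear_jacobi])
  finally have nH: "norm (ring_op a t L u') = norm (sym_jacobi a t u)" .
  have "u' \<in> span (bas ` {0..<L})"
    unfolding u'_def using L by (intro span_sum span_scale span_base) auto
  then have "r * norm u' \<le> norm (ring_op a t L u')"
    unfolding L_def by (intro ring N)
  then show ?thesis by (simp add: nu nH)
qed

end

section \<open>Spectral gaps and the oscillation of the diagonal\<close>

text \<open>Absorbs the point \<open>x\<close> into the diagonal, so that the ring estimates around
  0 apply around \<open>x\<close>.\<close>

lemma jacobi_shift_diagonal:
  assumes "periodic p a" "p \<ge> 1"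
  shows "sym_jacobi (\<lambda>i. a i - x) t u = sym_jacobi a t u - x *\<^sub>R u"
proof -
  have "periodic p (\<lambda>i. a i - x)" using assms(1) by (simp add: periodic_def)
  then show ?thesis
    using assms by (intro ell2_eqI) (simp add: nth_jacobi algebra_simps)
qed

text \<open>The block is one period without the site \<open>n\<close>; off-diagonal entries do not
  enter its trace, hence the last equation. For \<open>p = 1\<close> the block is empty.\<close>

lemma block_diagonalization:
  assumes a: "periodic p a" and p: "p \<ge> 1"
  obtains e :: "nat \<Rightarrow> ell2" and \<alpha> :: "nat \<Rightarrow> real"
  where "orthonormal_on e {..<p - 1}"
    "\<And>i. i < p - 1 \<Longrightarrow> e i \<in> span (bas ` {n + 1..<n + int p})"
    "\<And>i j. i < p - 1 \<Longrightarrow> j < p - 1 \<Longrightarrow>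
      e i \<bullet> sym_jacobi a t (e j) = \<alpha> i * of_bool (i = j)"
    "\<And>i j. i \<le> j \<Longrightarrow> j < p - 1 \<Longrightarrow> \<alpha> i \<le> \<alpha> j"
    "(\<Sum>i<p - 1. \<alpha> i) = (\<Sum>i\<in>{0..<int p}. a i) - a n"
proof -
  let ?I = "{n + 1..<n + int p}"
  have cI: "card ?I = p - 1" using p by simp
  have "{n..<n + int p} = insert n ?I" using p by auto
  then have "(\<Sum>i\<in>{n..<n + int p}. a i) = a n + (\<Sum>i\<in>?I. a i)" by simp
  then have tr: "(\<Sum>i\<in>?I. bas i \<bullet> sym_jacobi a t (bas i)) = (\<Sum>i\<in>{0..<int p}. a i) - a n"
    by (simp add: jacobi_bas_matrix[OF a p] sum_periodic_window[OF a])
  obtain e :: "nat \<Rightarrow> ell2" and \<alpha> where "orthonormal_on e {..<card ?I}"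
    "\<And>i. i < card ?I \<Longrightarrow> e i \<in> span (bas ` ?I)"
    "\<And>i j. i < card ?I \<Longrightarrow> j < card ?I \<Longrightarrow>
      e i \<bullet> sym_jacobi a t (e j) = \<alpha> i * of_bool (i = j)"
    "\<And>i j. i \<le> j \<Longrightarrow> j < card ?I \<Longrightarrow> \<alpha> i \<le> \<alpha> j"
    "(\<Sum>i<card ?I. \<alpha> i) = (\<Sum>i\<in>?I. bas i \<bullet> sym_jacobi a t (bas i))"
    by (rule symmetric_diagonalization[OF orthonormal_bas finite_atLeastLessThan_int
        bounded_linear_jacobi_const[OF a p] inner_jacobi[OF a p], of "n + 1" "n + int p" t])
       (rule that)
  then show ?thesis unfolding tr cI by (rule that)
qed

text \<open>The vectors \<open>v\<close> and \<open>w\<close> attain the two ends of the gap as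
  Rayleigh quotients and later locate approximate eigenvalues on either side of it.\<close>

lemma gap_from_oscillation:
  assumes a: "periodic p a" and p: "p \<ge> 1"
    and osc: "a n - a m > 2 * \<eta> * (real p - 1)" and \<eta>: "\<eta> \<ge> 0"
  obtains x r v w where "r > \<eta>"
    "\<And>u. r * norm u \<le> norm (sym_jacobi a t u - x *\<^sub>R u)"
    "norm v = 1" "v \<bullet> sym_jacobi a t v = x - r"
    "norm w = 1" "w \<bullet> sym_jacobi a t w = x + r"
proof -
  let ?H = "sym_jacobi a t"
  let ?d = "p - 1"
  obtain e \<alpha> where e: "orthonormal_on e {..<?d}"
    "\<And>i. i < ?d \<Longrightarrow> e i \<in> span (bas ` {n + 1..<n + int p})"
    "\<And>i j. i < ?d \<Longrightarrow> j < ?d \<Longrightarrow> e i \<bullet> ?H (e j) = \<alpha> i * of_bool (i = j)"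
    "\<And>i j. i \<le> j \<Longrightarrow> j < ?d \<Longrightarrow> \<alpha> i \<le> \<alpha> j"
    "(\<Sum>i<?d. \<alpha> i) = (\<Sum>i\<in>{0..<int p}. a i) - a n"
    using block_diagonalization[OF a p, of n t] by metis
  obtain g \<beta> where g: "orthonormal_on g {..<?d}"
    "\<And>i. i < ?d \<Longrightarrow> g i \<in> span (bas ` {m + 1..<m + int p})"
    "\<And>i j. i < ?d \<Longrightarrow> j < ?d \<Longrightarrow> g i \<bullet> ?H (g j) = \<beta> i * of_bool (i = j)"
    "\<And>i j. i \<le> j \<Longrightarrow> j < ?d \<Longrightarrow> \<beta> i \<le> \<beta> j"
    "(\<Sum>i<?d. \<beta> i) = (\<Sum>i\<in>{0..<int p}. a i) - a m"
    using block_diagonalization[OF a p, of m t] by metis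
  \<comment> \<open>Pigeonhole on the traces: the \<open>p - 1\<close> differences
    \<open>\<beta> i - \<alpha> i\<close> add up to \<open>a n - a m\<close>.\<close>
  have "\<exists>i<?d. \<beta> i - \<alpha> i > 2 * \<eta>"
  proof (rule ccontr)
    assume "\<not> (\<exists>i<?d. \<beta> i - \<alpha> i > 2 * \<eta>)"
    then have "\<beta> i - \<alpha> i \<le> 2 * \<eta>" if "i < ?d" for i using that by (meson not_less)
    then have "(\<Sum>i<?d. \<beta> i - \<alpha> i) \<le> (\<Sum>i<?d. 2 * \<eta>)" by (intro sum_mono) simp
    then have "a n - a m \<le> real ?d * (2 * \<eta>)" unfolding sum_subtractf e(5) g(5) by simp
    then show False using osc p by (simp add: of_nat_diff algebra_simps)
  qed
  then obtain i where i: "i < ?d" "\<beta> i - \<alpha> i > 2 * \<eta>" by blast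
  define x where "x = (\<alpha> i + \<beta> i) / 2"
  define r where "r = (\<beta> i - \<alpha> i) / 2"
  have r: "r > \<eta>" "\<alpha> i = x - r" "\<beta> i = x + r" using i(2) by (auto simp: r_def x_def field_simps)
  have r0: "r > 0" using r(1) \<eta> by simp
  let ?a = "\<lambda>i. a i - x"
  have a': "periodic p ?a" using a by (simp add: periodic_def)
  have Hx: "sym_jacobi ?a t u = ?H u - x *\<^sub>R u" for u
    by (rule jacobi_shift_diagonal[OF a p])
  have ee: "e k \<bullet> (?H (e l) - x *\<^sub>R e l) = (\<alpha> k - x) * of_bool (k = l)" if "k < ?d" "l < ?d" for k l
    using orthonormal_onD[OF e(1), of k l] e(3)[OF that] that by (simp add: inner_diff_right)
  have gg: "g k \<bullet> (?H (g l) - x *\<^sub>R g l) = (\<beta> k - x) * of_bool (k = l)" if "k < ?d" "l < ?d" for k l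
    using orthonormal_onD[OF g(1), of k l] g(3)[OF that] that by (simp add: inner_diff_right)
  have lo: "\<alpha> l - x \<le> - r" if "l \<le> i" for l using e(4)[OF that i(1)] r(2) by simp
  have hi: "r \<le> \<beta> l - x" if "i \<le> l" "l < ?d" for l using g(4)[OF that] r(3) by simp
  have ring: "r * norm u \<le> norm (ring_op ?a t (N * int p) u)"
    if "N > 0" "u \<in> span (bas ` {0..<N * int p})" for N u
  proof (rule ring_op_lower_bound[OF a' p _ _ _ _ _ _ _ _ _ _ _ r0 that, where e = e and A = "{..i}"
        and g = g and C = "{i..<?d}" and n = n and m = m])
    show "orthonormal_on e {..i}" "orthonormal_on g {i..<?d}"
      using e(1) g(1) i(1) by (auto simp: orthonormal_on_def)
    \<comment> \<open>The index \<open>i\<close> belongs to both families: \<open>i + 1\<close> low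
      and \<open>p - 1 - i\<close> high vectors make exactly \<open>p\<close>.\<close>
    show "p \<le> card {..i} + card {i..<?d}" using i(1) by simp
  qed (use e(2) g(2) i(1) lo hi in \<open>auto simp: Hx ee gg\<close>)
  have fin: "r * norm u \<le> norm (?H u - x *\<^sub>R u)" if "finite F" "u \<in> span (bas ` F)" for F u
    unfolding Hx[symmetric] by (rule jacobi_lower_bound_from_ring[OF a' p ring that])
  have "r * norm u \<le> norm (?H u - x *\<^sub>R u)" for u
    by (rule jacobi_lower_bound_from_finite[OF a p fin less_imp_le[OF r0]])
  moreover have "norm (e i) = 1" "norm (g i) = 1"
    using orthonormal_onD[OF e(1), of i i] orthonormal_onD[OF g(1), of i i] i(1) by (auto simp: norm_eq_1)
  moreover have "e i \<bullet> ?H (e i) = x - r" "g i \<bullet> ?H (g i) = x + r"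
    using e(3)[OF i(1) i(1)] g(3)[OF i(1) i(1)] r by auto
  ultimately show ?thesis using that[of r x "e i" "g i"] r(1) by blast
qed

text \<open>In the real inner product \<open>(Re z - A) u\<close> and \<open>\<i> * Im z\<close>
  times \<open>u\<close> are orthogonal, because self-adjointness makes the complex inner product of
  \<open>u\<close> with \<open>(Re z - A) u\<close> real; Pythagoras does the rest.\<close>

lemma norm_sq_scaleC_diff:
  fixes A :: "ell2 \<Rightarrow> ell2"
  assumes sym: "\<And>u v. cinner (A u) v = cinner u (A v)"
  shows "(norm (z *\<^sub>C u - A u))\<^sup>2 = (norm (A u - Re z *\<^sub>R u))\<^sup>2 + (Im z * norm u)\<^sup>2"
proof -
  define v where "v = Re z *\<^sub>R u - A u"
  have "z *\<^sub>C u - A u = v + (\<i> * Im z) *\<^sub>C u"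
    by (rule ell2_eqI) (simp add: v_def, subst complex_eq[of z], simp add: algebra_simps)
  moreover have "cinner u v = cinner v u"
  proof -
    have "v = complex_of_real (Re z) *\<^sub>C u + (- 1) *\<^sub>C A u"
      by (rule ell2_eqI) (simp add: v_def)
    then show ?thesis
      by (simp only: cinner_add_left cinner_add_right cinner_scaleC_left cinner_scaleC_right sym) simp
  qed
  then have "Im (cinner u v) = 0"
    by (metis Reals_cnj_iff cinner_commute complex_is_Real_iff)
  then have "v \<bullet> ((\<i> * Im z) *\<^sub>C u) = 0"
    by (subst inner_commute) (simp add: inner_eq_Re_cinner cinner_scaleC_left)
  ultimately have "(norm (z *\<^sub>C u - A u))\<^sup>2 = (norm v)\<^sup>2 + (norm ((\<i> * Im z) *\<^sub>C u))\<^sup>2"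
    by (simp add: power2_norm_eq_inner inner_add_left inner_add_right inner_commute)
  then show ?thesis
    by (simp add: v_def norm_minus_commute norm_scaleC_ell2 norm_mult power_mult_distrib)
qed

section \<open>From a gap of the symmetric operator to the pseudospectrum of
  \<open>J\<close>\<close>

context
  fixes p :: nat and a :: "int \<Rightarrow> real"
  assumes a: "periodic p a" and p: "p \<ge> 1"
begin

text \<open>Leaving the real axis can only increase the norm for the symmetric operator, and passing
  to the non-symmetric one loses at most
  \<open>\<bar>\<beta> - \<gamma>\<bar> * norm u\<close>.\<close>

lemma jacobi_lower_bound_off_gap:
  assumes gap: "\<And>u. r * norm u \<le> norm (sym_jacobi a ((\<beta> + \<gamma>) / 2) u - Re z *\<^sub>R u)"
    and r: "r \<ge> 0"
  shows "(r - \<bar>\<beta> - \<gamma>\<bar>) * norm u \<le> norm (z *\<^sub>C u - jacobi a (\<lambda>_. \<beta>) (\<lambda>_. \<gamma>) u)"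
proof -
  let ?H = "sym_jacobi a ((\<beta> + \<gamma>) / 2)"
  have "(r * norm u)\<^sup>2 \<le> (norm (?H u - Re z *\<^sub>R u))\<^sup>2"
    using gap r by (intro power_mono) auto
  also have "\<dots> \<le> (norm (z *\<^sub>C u - ?H u))\<^sup>2"
    by (simp add: norm_sq_scaleC_diff[where A = ?H, OF cinner_jacobi[OF a p]])
  finally have "r * norm u \<le> norm (z *\<^sub>C u - ?H u)" by (rule power2_le_imp_le) simp
  also have "\<dots> \<le> norm (z *\<^sub>C u - jacobi a (\<lambda>_. \<beta>) (\<lambda>_. \<gamma>) u) + norm (jacobi a (\<lambda>_. \<beta>) (\<lambda>_. \<gamma>) u - ?H u)"
    using norm_triangle_ineq[of "z *\<^sub>C u - jacobi a (\<lambda>_. \<beta>) (\<lambda>_. \<gamma>) u" "jacobi a (\<lambda>_. \<beta>) (\<lambda>_. \<gamma>) u - ?H u"]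
    by simp
  also have "norm (jacobi a (\<lambda>_. \<beta>) (\<lambda>_. \<gamma>) u - ?H u) \<le> \<bar>\<beta> - \<gamma>\<bar> * norm u"
    by (rule norm_jacobi_diff[OF a p])
  finally show ?thesis by (simp add: algebra_simps)
qed

text \<open>The adjoint of \<open>z - J\<close> is \<open>cnj z - J'\<close> with the off-diagonals
  exchanged. Symmetric part and \<open>Re z\<close> are the same for both, so one gap hypothesis
  yields both lower bounds, and the one for the adjoint gives surjectivity.\<close>

lemma gap_line_avoids_pseudospectrum:
  assumes gap: "\<And>u. r * norm u \<le> norm (sym_jacobi a ((\<beta> + \<gamma>) / 2) u - Re z *\<^sub>R u)"
    and r: "\<epsilon> + \<bar>\<beta> - \<gamma>\<bar> < r" and \<epsilon>: "\<epsilon> \<ge> 0"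
  shows "z \<notin> pseudospectrum \<epsilon> (jacobi a (\<lambda>_. \<beta>) (\<lambda>_. \<gamma>))"
proof -
  let ?J = "jacobi a (\<lambda>_. \<beta>) (\<lambda>_. \<gamma>)" and ?J' = "jacobi a (\<lambda>_. \<gamma>) (\<lambda>_. \<beta>)"
  define \<kappa> where "\<kappa> = r - \<bar>\<beta> - \<gamma>\<bar>"
  have \<kappa>: "\<epsilon> < \<kappa>" "\<kappa> > 0" using r \<epsilon> by (auto simp: \<kappa>_def)
  have r0: "r \<ge> 0" using r \<epsilon> by linarith
  have lin: "bounded_linear (\<lambda>u :: ell2. w *\<^sub>C u)" for w
  proof (rule bounded_linear_intro)
    show "w *\<^sub>C (x + y) = w *\<^sub>C x + w *\<^sub>C y" for x y :: ell2 by (rule scaleC_add_right)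
    show "w *\<^sub>C (s *\<^sub>R x) = s *\<^sub>R (w *\<^sub>C x)" for s and x :: ell2 by (rule ell2_eqI) simp
    show "norm (w *\<^sub>C x) \<le> norm x * cmod w" for x :: ell2 by (simp add: norm_scaleC_ell2)
  qed
  have low: "\<kappa> * norm u \<le> norm (z *\<^sub>C u - ?J u)" for u
    unfolding \<kappa>_def by (rule jacobi_lower_bound_off_gap[OF gap r0])
  have low': "\<kappa> * norm u \<le> norm (cnj z *\<^sub>C u - ?J' u)" for u
    using jacobi_lower_bound_off_gap[of r \<gamma> \<beta> "cnj z" u] gap r0
    by (simp add: \<kappa>_def add.commute abs_minus_commute)
  have adj: "(z *\<^sub>C u - ?J u) \<bullet> v = u \<bullet> (cnj z *\<^sub>C v - ?J' v)" for u v
    unfolding inner_diff_left inner_diff_right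
    by (simp add: inner_eq_Re_cinner cinner_jacobi[OF a p] cinner_scaleC_left cinner_scaleC_right)
  show ?thesis
  proof (rule not_in_pseudospectrum[where A = ?J, OF _ _ _ low \<kappa>(1) \<epsilon>])
    show bl: "bounded_linear (\<lambda>u. z *\<^sub>C u - ?J u)"
      by (intro bounded_linear_sub lin bounded_linear_jacobi_const[OF a p])
    show "?J (w *\<^sub>C u) = w *\<^sub>C ?J u" for w u
      using bounded_clinear_jacobi_const[OF a p] by (simp add: bounded_clinear_def)
    show "surj (\<lambda>u. z *\<^sub>C u - ?J u)"
      by (rule surj_if_adjoint_bounded_below[OF bl _ adj \<kappa>(2) low'])
         (intro bounded_linear_sub lin bounded_linear_jacobi_const[OF a p])
  qed
qed

text \<open>Replacing the symmetric operator by \<open>J\<close> adds at most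
  \<open>\<bar>\<beta> - \<gamma>\<bar>\<close> to the residual of an approximate unit eigenvector,
  which \<epsilon> tolerates.\<close>

lemma approximate_eigenvalue_in_pseudospectrum:
  assumes approx: "\<And>e. e > 0 \<Longrightarrow>
      \<exists>u. norm u = 1 \<and> norm (l *\<^sub>R u - sym_jacobi a ((\<beta> + \<gamma>) / 2) u) \<le> e"
    and \<epsilon>: "\<bar>\<beta> - \<gamma>\<bar> \<le> \<epsilon>"
  shows "complex_of_real l \<in> pseudospectrum \<epsilon> (jacobi a (\<lambda>_. \<beta>) (\<lambda>_. \<gamma>))"
proof (rule in_pseudospectrum[OF _ _ \<epsilon>])
  fix e :: real assume "e > 0"
  let ?J = "jacobi a (\<lambda>_. \<beta>) (\<lambda>_. \<gamma>)" and ?H = "sym_jacobi a ((\<beta> + \<gamma>) / 2)"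
  from approx[OF \<open>e > 0\<close>] obtain u where u: "norm u = 1" "norm (l *\<^sub>R u - ?H u) \<le> e" by blast
  have "norm (l *\<^sub>R u - ?J u) \<le> norm (l *\<^sub>R u - ?H u) + norm (?J u - ?H u)"
    using norm_triangle_ineq4[of "l *\<^sub>R u - ?H u" "?J u - ?H u"] by simp
  also have "\<dots> \<le> \<bar>\<beta> - \<gamma>\<bar> + e" using u norm_jacobi_diff[OF a p, of \<beta> \<gamma> u] by simp
  finally show "\<exists>u. norm u = 1 \<and> norm (complex_of_real l *\<^sub>C u - ?J u) \<le> \<bar>\<beta> - \<gamma>\<bar> + e"
    using u(1) by (auto simp: scaleC_of_real)
qed simp

lemma difference_le_if_pseudospectrum_connected:
  assumes \<epsilon>: "\<bar>\<beta> - \<gamma>\<bar> \<le> \<epsilon>"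
    and conn: "connected (pseudospectrum \<epsilon> (jacobi a (\<lambda>_. \<beta>) (\<lambda>_. \<gamma>)))"
  shows "a n - a m \<le> 2 * (\<epsilon> + \<bar>\<beta> - \<gamma>\<bar>) * (real p - 1)"
proof (rule ccontr)
  assume "\<not> ?thesis"
  then have big: "a n - a m > 2 * (\<epsilon> + \<bar>\<beta> - \<gamma>\<bar>) * (real p - 1)" by simp
  let ?H = "sym_jacobi a ((\<beta> + \<gamma>) / 2)"
  let ?S = "pseudospectrum \<epsilon> (jacobi a (\<lambda>_. \<beta>) (\<lambda>_. \<gamma>))"
  have \<epsilon>0: "\<epsilon> \<ge> 0" "\<epsilon> + \<bar>\<beta> - \<gamma>\<bar> \<ge> 0" using \<epsilon> by auto
  obtain x r v w where gap: "r > \<epsilon> + \<bar>\<beta> - \<gamma>\<bar>"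
    "\<And>u. r * norm u \<le> norm (?H u - x *\<^sub>R u)"
    "norm v = 1" "v \<bullet> ?H v = x - r" "norm w = 1" "w \<bullet> ?H w = x + r"
    using gap_from_oscillation[OF a p big \<epsilon>0(2), of "(\<beta> + \<gamma>) / 2"] by metis
  have r0: "r > 0" using gap(1) \<epsilon>0 by simp
  note bl = bounded_linear_jacobi_const[OF a p, of "(\<beta> + \<gamma>) / 2" "(\<beta> + \<gamma>) / 2"]
  note sym = inner_jacobi[OF a p, of _ "(\<beta> + \<gamma>) / 2"]
  obtain l where l: "w \<bullet> ?H w \<le> l" "\<And>e. e > 0 \<Longrightarrow> \<exists>u. norm u = 1 \<and> norm (l *\<^sub>R u - ?H u) \<le> e"
    using rayleigh_sup_approximate_eigenvalue[OF bl sym gap(5)] by metis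
  \<comment> \<open>Applied to \<open>- ?H\<close>, the same supremum argument gives an approximate
    eigenvalue \<open>- k\<close> of \<open>?H\<close> at or below \<open>x - r\<close>.\<close>
  have symn: "u \<bullet> - ?H v = - ?H u \<bullet> v" for u v by (simp add: sym)
  obtain k where k: "v \<bullet> - ?H v \<le> k" "\<And>e. e > 0 \<Longrightarrow> \<exists>u. norm u = 1 \<and> norm (k *\<^sub>R u - - ?H u) \<le> e"
    using rayleigh_sup_approximate_eigenvalue[OF bounded_linear_minus[OF bl] symn gap(3)] by metis
  have "norm (k *\<^sub>R u - - ?H u) = norm ((- k) *\<^sub>R u - ?H u)" for u
  proof -
    have "k *\<^sub>R u - - ?H u = - ((- k) *\<^sub>R u - ?H u)" by simp
    then show ?thesis by (simp only: norm_minus_cancel)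
  qed
  with k(2) have k': "\<exists>u. norm u = 1 \<and> norm ((- k) *\<^sub>R u - ?H u) \<le> e" if "e > 0" for e
    using that by metis
  have lS: "complex_of_real l \<in> ?S" by (rule approximate_eigenvalue_in_pseudospectrum[OF l(2) \<epsilon>])
  have kS: "complex_of_real (- k) \<in> ?S" by (rule approximate_eigenvalue_in_pseudospectrum[OF k' \<epsilon>])
  have avoid: "Re z \<noteq> x" if "z \<in> ?S" for z
  proof
    assume "Re z = x"
    then have "z \<notin> ?S" using gap(2) by (intro gap_line_avoids_pseudospectrum[OF _ gap(1) \<epsilon>0(1)]) simp
    then show False using that by simp
  qed
  \<comment> \<open>The real parts of a connected set form an interval; it has points on both sides
    of \<open>x\<close> and so contains \<open>x\<close>.\<close>
  have "connected (Re ` ?S)" by (intro connected_continuous_image conn continuous_intros)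
  then have "x \<in> Re ` ?S"
    by (rule connectedD_interval[of _ "- k" l])
       (use lS kS l(1) k(1) gap(4,6) r0 in \<open>auto intro: image_eqI[where x = "complex_of_real _"]\<close>)
  then show False using avoid by blast
qed

end

theorem theorem3p4:
  fixes p :: nat
    and a b c :: "int \<Rightarrow> real"
    and \<beta> \<gamma> \<epsilon> :: real
  assumes "p \<ge> 1"
    and "periodic p a" and "periodic p b" and "periodic p c"
    and "\<forall>i\<in>{0..<int p}. b i = \<beta>"
    and "\<forall>i\<in>{0..<int p}. c i = \<gamma>"
    and "\<epsilon> \<ge> \<bar>\<beta> - \<gamma>\<bar>"
    and "path_connected (pseudospectrum \<epsilon> (jacobi a b c))"
  shows "osc a \<le> 2 * (\<epsilon> + \<bar>\<beta> - \<gamma>\<bar>) * (real p - 1)"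
proof -
  have "b = (\<lambda>_. \<beta>)" "c = (\<lambda>_. \<gamma>)"
    using periodic_mod[OF assms(3)] periodic_mod[OF assms(4)] assms(1,5,6) by (auto intro!: ext)
  then have conn: "connected (pseudospectrum \<epsilon> (jacobi a (\<lambda>_. \<beta>) (\<lambda>_. \<gamma>)))"
    using assms(8) path_connected_imp_connected by simp
  note le = difference_le_if_pseudospectrum_connected[OF assms(2,1,7) conn]
  show ?thesis
    unfolding osc_def
  proof (rule Max.boundedI[OF finite_differences[OF assms(2,1)]])
    show "{\<bar>a (int i) - a (int j)\<bar> | i j. True} \<noteq> {}" by blast
    fix y assume "y \<in> {\<bar>a (int i) - a (int j)\<bar> | i j. True}"
    then obtain i j where "y = \<bar>a (int i) - a (int j)\<bar>" by blast
    then show "y \<le> 2 * (\<epsilon> + \<bar>\<beta> - \<gamma>\<bar>) * (real p - 1)"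
      using le[of "int i" "int j"] le[of "int j" "int i"] by linarith
  qed
qed

end
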